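(* Let $(\xi_i)_{i\in\mathbb{Z}}$ be i.i.d. centered random variables with finite second moment $\sigma^2=\mathbb{E}\xi_0^2>0$, and assume that $\mathbb{E}|\xi_0|^p<\infty$ for a certain $p>2$. Let $c_{ni}$ ($n\ge1$, $1\le i\le k_n$) be real constants, not all zero for each $n$, $S_n=\sum_{i=1}^{k_n}c_{ni}\xi_i$, $\sigma_n^2=\mathrm{var}(S_n)=\sigma^2\sum_{i=1}^{k_n}c_{ni}^2$, and assume $\max_{1\le i\le k_n}c_{ni}^2/\sigma_n^2\to0$ as $n\to\infty$. Put $D_{np}=\big(\sum_{i=1}^{k_n}c_{ni}^2\big)^{-p/2}\sum_{i=1}^{k_n}|c_{ni}|^p$. If $x_n^2\le2\ln(D_{np}^{-1})$, then $$\mathbb{P}(S_n\ge x_n\sigma_n)=(1-\Phi(x_n))(1+o(1))\quad\text{as }n\to\infty.$$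
   Context: $\Phi$ is the standard normal distribution function. $k_n$ are positive integers. $o(1)$ denotes a sequence, which may depend on $(x_n)$ and on the underlying distribution, converging to $0$ as $n\to\infty$. *)

theory Defs
  imports "HOL-Probability.Probability"
begin

definition std_normal_cdf :: "real \<Rightarrow> real" where
  "std_normal_cdf = cdf std_normal_distribution"

text \<open>The \<open>indep_vars\<close> clause also gives measurability.\<close>
definition iid_rvs :: "'a measure \<Rightarrow> (int \<Rightarrow> 'a \<Rightarrow> real) \<Rightarrow> bool" where
  "iid_rvs M \<xi> \<longleftrightarrow>
     prob_space.indep_vars M (\<lambda>_. borel) \<xi> UNIV \<and>
     (\<forall>i j. distr M borel (\<xi> i) = distr M borel (\<xi> j))"

text \<open>\<open>k n\<close> is the length of the \<open>n\<close>-th row of coefficients \<open>c n 1, \<dots>, c n (k n)\<close>.\<close>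
definition weighted_sum ::
    "(nat \<Rightarrow> nat \<Rightarrow> real) \<Rightarrow> (nat \<Rightarrow> nat) \<Rightarrow> (int \<Rightarrow> 'a \<Rightarrow> real) \<Rightarrow> nat \<Rightarrow> 'a \<Rightarrow> real" where
  "weighted_sum c k \<xi> n \<omega> = (\<Sum>i=1..k n. c n i * \<xi> (int i) \<omega>)"

definition weighted_sum_sd ::
    "'a measure \<Rightarrow> (nat \<Rightarrow> nat \<Rightarrow> real) \<Rightarrow> (nat \<Rightarrow> nat) \<Rightarrow> (int \<Rightarrow> 'a \<Rightarrow> real) \<Rightarrow> nat \<Rightarrow> real" where
  "weighted_sum_sd M c k \<xi> n = sqrt (prob_space.variance M (weighted_sum c k \<xi> n))"

definition lyapunov_ratio ::
    "(nat \<Rightarrow> nat \<Rightarrow> real) \<Rightarrow> (nat \<Rightarrow> nat) \<Rightarrow> real \<Rightarrow> nat \<Rightarrow> real" where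
  "lyapunov_ratio c k p n =
     (\<Sum>i=1..k n. (c n i)\<^sup>2) powr (- p / 2) * (\<Sum>i=1..k n. \<bar>c n i\<bar> powr p)"

end

theory Submission
  imports Defs "HOL-Real_Asymp.Real_Asymp"
begin

text \<open>
  The proof is a Lindeberg replacement with exponential weights. Normalize the summands to \<open>X\<^sub>i\<close> with variances
  adding up to \<open>1\<close>, cut them off at the level \<open>y = x / 8\<close>, and exchange them one at a time for normal variables
  under a smooth test function that rises from \<open>0\<close> to \<open>1\<close> on an interval of length \<open>\<delta> = 1 / x\<^sup>2\<close> at \<open>x\<close>. Its
  derivatives at \<open>s\<close> are at most a constant times \<open>\<delta>\<close> to the power \<open>- 3\<close> times \<open>exp (h * (s - x))\<close>, so with \<open>h = x\<close>
  and the moment generating function of the remaining sum, which is about \<open>exp (h\<^sup>2 / 2)\<close>, each exchange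
  costs \<open>exp (- x\<^sup>2 / 2)\<close> times a polynomial in \<open>x\<close> times an exponentially weighted third moment of one summand. As the
  Lyapunov ratio is at most \<open>exp (- x\<^sup>2 / 2)\<close> and the cut-off keeps \<open>exp (h * y)\<close> below \<open>exp (x\<^sup>2 / 8)\<close>, these
  third moments add up to an exponentially small quantity. The cut-off itself costs at most
  \<open>exp (- x\<^sup>2 / 2) * y powr (- p)\<close> up to a constant. Both errors are negligible against the normal tail, which is of
  order \<open>exp (- x\<^sup>2 / 2) / x\<close>. For bounded \<open>x\<close> the same estimate with \<open>h = 0\<close> is a uniform central limit theorem.
\<close>

section \<open>Smoothed indicator functions\<close>

text \<open>Freezing \<open>f\<close> outside \<open>[a, b]\<close> keeps it differentiable because
  its derivative is 0 at both ends: there the one-sided derivatives from the constant side and from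
  the inner side agree. This glues the polynomial of the smooth step to its constant values.\<close>

lemma has_real_derivative_clamp:
  fixes f f' :: "real \<Rightarrow> real"
  assumes d: "\<And>t. (f has_real_derivative f' t) (at t)"
    and z: "f' a = 0" "f' b = 0" and ab: "a < b"
  shows "((\<lambda>t. f (max a (min b t))) has_real_derivative f' (max a (min b t))) (at t)"
proof -
  consider "t < a" | "t = a" | "a < t" "t < b" | "t = b" | "b < t" by linarith
  then show ?thesis
  proof cases
    case 1
    show ?thesis
      by (rule has_field_derivative_transform_within_open[of "\<lambda>_. f a" _ _ "{..<a}"])
        (use 1 z ab in \<open>auto simp: max_def min_def\<close>)
  next
    case 2
    have "((\<lambda>t. f (max a (min b t))) has_real_derivative 0) (at a within {..a})"
      by (rule has_field_derivative_transform_within[of "\<lambda>_. f a" _ _ _ 1])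
        (use ab in \<open>auto simp: max_def min_def\<close>)
    moreover have "((\<lambda>t. f (max a (min b t))) has_real_derivative 0) (at a within {a..})"
      by (rule has_field_derivative_transform_within[of f _ _ _ "b - a"])
        (use ab z d[of a] in \<open>auto simp: max_def min_def dist_real_def intro: has_field_derivative_at_within\<close>)
    ultimately have "((\<lambda>t. f (max a (min b t))) has_real_derivative 0) (at a within ({..a} \<union> {a..}))"
      unfolding has_field_derivative_iff by (intro Lim_Un)
    moreover have "{..a} \<union> {a..} = UNIV" by auto
    ultimately show ?thesis using 2 z ab by (simp add: max_def min_def)
  next
    case 3
    show ?thesis
      by (rule has_field_derivative_transform_within_open[of f _ _ "{a<..<b}"])
        (use 3 d[of t] in \<open>auto simp: max_def min_def\<close>)
  next
    case 4
    have "((\<lambda>t. f (max a (min b t))) has_real_derivative 0) (at b within {b..})"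
      by (rule has_field_derivative_transform_within[of "\<lambda>_. f b" _ _ _ 1])
        (use ab in \<open>auto simp: max_def min_def\<close>)
    moreover have "((\<lambda>t. f (max a (min b t))) has_real_derivative 0) (at b within {..b})"
      by (rule has_field_derivative_transform_within[of f _ _ _ "b - a"])
        (use ab z d[of b] in \<open>auto simp: max_def min_def dist_real_def intro: has_field_derivative_at_within\<close>)
    ultimately have "((\<lambda>t. f (max a (min b t))) has_real_derivative 0) (at b within ({b..} \<union> {..b}))"
      unfolding has_field_derivative_iff by (intro Lim_Un)
    moreover have "{b..} \<union> {..b} = UNIV" by auto
    ultimately show ?thesis using 4 z ab by (simp add: max_def min_def)
  next
    case 5
    show ?thesis
      by (rule has_field_derivative_transform_within_open[of "\<lambda>_. f b" _ _ "{b<..}"])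
        (use 5 z ab in \<open>auto simp: max_def min_def\<close>)
  qed
qed

text \<open>\<open>F j\<close> is the \<open>j\<close>-th derivative of \<open>F 0\<close>, a smoothed indicator of \<open>{a..}\<close>.\<close>
definition smooth_step :: "real \<Rightarrow> real \<Rightarrow> (nat \<Rightarrow> real \<Rightarrow> real) \<Rightarrow> bool" where
  "smooth_step a \<delta> F \<longleftrightarrow>
     (\<forall>j<3. \<forall>s. (F j has_real_derivative F (Suc j) s) (at s)) \<and>
     (\<forall>s. 0 \<le> F 0 s \<and> F 0 s \<le> 1) \<and> (\<forall>s\<le>a. F 0 s = 0) \<and> (\<forall>s\<ge>a + \<delta>. F 0 s = 1) \<and>
     (\<forall>j\<in>{1..3}. (\<forall>s\<le>a. F j s = 0) \<and> (\<forall>s. \<bar>F j s\<bar> \<le> 840 / \<delta> ^ 3))"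

text \<open>The profile is the polynomial of degree 7 with derivative
  \<open>140 * t^3 * (1-t)^3\<close>, where 140 normalizes the total increase to 1. The triple zeros
  at 0 and 1 make the first three derivatives vanish at both ends, so clamping the argument to
  \<open>[0, 1]\<close> preserves the derivative relations.\<close>

lemma smooth_step_unit_exists: "\<exists>F. smooth_step 0 1 F"
proof -
  define P :: "nat \<Rightarrow> real \<Rightarrow> real" where
    "P j = [\<lambda>t. 35*t^4 - 84*t^5 + 70*t^6 - 20*t^7, \<lambda>t. 140*t^3*(1-t)^3,
            \<lambda>t. 420*t^2*(1-t)^2*(1-2*t), \<lambda>t. 840*t*(1-t)*(1-5*t+5*t^2)] ! j" for j
  define c :: "real \<Rightarrow> real" where "c s = max 0 (min 1 s)" for s
  have j3: "j < 3 \<Longrightarrow> j = 0 \<or> j = 1 \<or> j = 2" for j :: nat by auto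
  have dP: "(P j has_real_derivative P (Suc j) t) (at t)" if jlt: "j < 3" for j t
  proof -
    have P: "P 0 = (\<lambda>t. 35*t^4 - 84*t^5 + 70*t^6 - 20*t^7)" "P 1 = (\<lambda>t. 140*t^3*(1-t)^3)"
      "P 2 = (\<lambda>t. 420*t^2*(1-t)^2*(1-2*t))" "P 3 = (\<lambda>t. 840*t*(1-t)*(1-5*t+5*t^2))"
      by (simp_all add: P_def)
    have "(P 0 has_real_derivative P 1 t) (at t)"
      unfolding P by (rule derivative_eq_intros refl)+ (simp add: eval_nat_numeral, algebra)
    moreover have "(P 1 has_real_derivative P 2 t) (at t)"
      unfolding P by (rule derivative_eq_intros refl)+ (simp add: eval_nat_numeral, algebra)
    moreover have "(P 2 has_real_derivative P 3 t) (at t)"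
      unfolding P by (rule derivative_eq_intros refl)+ (simp add: eval_nat_numeral, algebra)
    ultimately show ?thesis using j3[OF jlt] by (auto simp: eval_nat_numeral)
  qed
  have z: "P (Suc j) 0 = 0 \<and> P (Suc j) 1 = 0" if "j < 3" for j
    using j3[OF that] by (auto simp: P_def numeral_eq_Suc)
  have c01: "0 \<le> c s" "c s \<le> 1" for s by (auto simp: c_def)
  have d: "((\<lambda>s. P j (c s)) has_real_derivative P (Suc j) (c s)) (at s)" if "j < 3" for j s
    unfolding c_def by (rule has_real_derivative_clamp) (use dP z that in auto)
  have mono: "P 0 s \<le> P 0 t" if "0 \<le> s" "s \<le> t" "t \<le> 1" for s t
  proof (rule DERIV_nonneg_imp_nondecreasing[OF that(2)])
    fix u assume "s \<le> u" "u \<le> t"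
    then have "P 1 u \<ge> 0" using that by (auto simp: P_def)
    then show "\<exists>y. (P 0 has_real_derivative y) (at u) \<and> 0 \<le> y"
      using dP[of 0 u] by auto
  qed
  have P01: "P 0 0 = 0" "P 0 1 = 1" by (auto simp: P_def)
  \<comment> \<open>With u = t(1-t), which lies in [0, 1/4], the three polynomials are 140 u^3, 420
    u^2 (1-2t) and 840 u (1-5u). All factors other than the constants are at most 1 in absolute
    value.\<close>
  have bd: "\<bar>P j t\<bar> \<le> 840" if j: "j \<in> {1..3}" and t: "0 \<le> t" "t \<le> 1" for j t
  proof -
    have a: "0 \<le> t*(1-t)" "t*(1-t) \<le> 1" using t by (auto simp: mult_le_one)
    have b: "0 \<le> (t*(1-t))^k" "(t*(1-t))^k \<le> 1" for k using a by (auto simp: power_le_one)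
    have e: "\<bar>1-2*t\<bar> \<le> 1" using t by auto
    have "0 \<le> t * (1 - t)" "t*(1-t) \<le> 1/4"
      using a zero_le_power2[of "t - 1/2"] by (auto simp: power2_eq_square algebra_simps)
    moreover have "1-5*t+5*t^2 = 1 - 5 * (t*(1-t))" by (simp add: power2_eq_square algebra_simps)
    ultimately have f: "\<bar>1-5*t+5*t^2\<bar> \<le> 1" by linarith
    have "P 1 t = 140 * (t*(1-t))^3" by (simp add: P_def power_mult_distrib)
    moreover have "P 2 t = 420 * ((t*(1-t))^2 * (1-2*t))" by (simp add: P_def power_mult_distrib)
    moreover have "P 3 t = 840 * ((t*(1-t))^1 * (1-5*t+5*t^2))" by (simp add: P_def)
    moreover have "\<bar>(t*(1-t))^2 * (1-2*t)\<bar> \<le> 1" "\<bar>(t*(1-t))^1 * (1-5*t+5*t^2)\<bar> \<le> 1"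
      unfolding abs_mult using b[of 2] b[of 1] e f by (auto intro!: mult_le_one simp del: power_one_right)
    ultimately have "\<bar>P 1 t\<bar> \<le> 840" "\<bar>P 2 t\<bar> \<le> 840" "\<bar>P 3 t\<bar> \<le> 840"
      using b[of 3] unfolding abs_mult[of "420"] abs_mult[of "840"] by simp_all
    moreover have "j = 1 \<or> j = 2 \<or> j = 3" using j by auto
    ultimately show ?thesis by blast
  qed
  have "smooth_step 0 1 (\<lambda>j s. P j (c s))"
    unfolding smooth_step_def
  proof (intro conjI allI ballI impI)
    fix s j assume "j < (3::nat)"
    then show "((\<lambda>s. P j (c s)) has_real_derivative P (Suc j) (c s)) (at s)" by (rule d)
  next
    fix s
    show "0 \<le> P 0 (c s)" "P 0 (c s) \<le> 1" using mono[of 0 "c s"] mono[of "c s" 1] c01[of s] P01 by auto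
  next
    fix s :: real assume "s \<le> 0" then show "P 0 (c s) = 0" using P01 by (simp add: c_def)
  next
    fix s :: real assume "0 + 1 \<le> s" then show "P 0 (c s) = 1" using P01 by (simp add: c_def)
  next
    fix s :: real and j :: nat assume j: "j \<in> {1..3}" and s: "s \<le> 0"
    obtain i where "j = Suc i" "i < 3" using j by (cases j) auto
    then show "P j (c s) = 0" using z[of i] s by (simp add: c_def)
  next
    fix s and j :: nat assume "j \<in> {1..3}" then show "\<bar>P j (c s)\<bar> \<le> 840 / 1 ^ 3"
      using bd[of j "c s"] c01[of s] by simp
  qed
  then show ?thesis by blast
qed

text \<open>Rescaling the unit step divides the \<open>j\<close>-th derivative by
  \<open>\<delta> ^ j\<close>, which is at least \<open>\<delta> ^ 3\<close> because \<delta> is at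
  most 1.\<close>

lemma smooth_step_exists:
  assumes \<delta>: "0 < \<delta>" "\<delta> \<le> 1"
  shows "\<exists>F. smooth_step a \<delta> F"
proof -
  obtain F where F: "smooth_step 0 1 F" using smooth_step_unit_exists by blast
  define G where "G j s = F j ((s - a) / \<delta>) / \<delta> ^ j" for j s
  have arg: "(s - a) / \<delta> \<le> 0 \<longleftrightarrow> s \<le> a" "1 \<le> (s - a) / \<delta> \<longleftrightarrow> a + \<delta> \<le> s" for s
    using \<delta> by (auto simp: field_simps)
  have "smooth_step a \<delta> G"
    unfolding smooth_step_def
  proof (intro conjI allI ballI impI)
    fix s j assume "j < (3::nat)"
    then have "(F j has_real_derivative F (Suc j) ((s - a) / \<delta>)) (at ((s - a) / \<delta>))"
      using F by (auto simp: smooth_step_def)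
    then have "((\<lambda>s. F j ((s - a) / \<delta>)) has_real_derivative F (Suc j) ((s - a) / \<delta>) * (1 / \<delta>)) (at s)"
      by (rule DERIV_chain2) (use \<delta> in \<open>auto intro!: derivative_eq_intros\<close>)
    then have "((\<lambda>s. F j ((s - a) / \<delta>) / \<delta> ^ j) has_real_derivative
        F (Suc j) ((s - a) / \<delta>) * (1 / \<delta>) / \<delta> ^ j) (at s)" by (rule DERIV_cdivide)
    then show "(G j has_real_derivative G (Suc j) s) (at s)"
      using \<delta> by (simp add: G_def[abs_def] field_simps)
  next
    fix s and j :: nat assume j: "j \<in> {1..3}"
    then have 1: "\<bar>F j ((s - a) / \<delta>)\<bar> \<le> 840" using F by (auto simp: smooth_step_def)
    have "\<delta> ^ 3 \<le> \<delta> ^ j" using j \<delta> by (intro power_decreasing) auto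
    then have "840 / \<delta> ^ j \<le> 840 / \<delta> ^ 3" using \<delta> by (intro divide_left_mono) auto
    moreover have "\<bar>G j s\<bar> \<le> 840 / \<delta> ^ j"
      unfolding G_def abs_divide using 1 \<delta> by (auto intro!: divide_right_mono)
    ultimately show "\<bar>G j s\<bar> \<le> 840 / \<delta> ^ 3" by simp
  next
    fix s show "0 \<le> G 0 s" "G 0 s \<le> 1" using F by (auto simp: smooth_step_def G_def)
  next
    fix s assume "s \<le> a" then show "G 0 s = 0"
      using F arg(1)[of s] unfolding smooth_step_def by (auto simp: G_def)
  next
    fix s assume "a + \<delta> \<le> s"
    then have "F 0 ((s - a) / \<delta>) = 1" using F arg(2)[of s] unfolding smooth_step_def by auto
    then show "G 0 s = 1" by (simp add: G_def)
  next
    fix s and j :: nat assume "j \<in> {1..3}" "s \<le> a"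
    then have "F j ((s - a) / \<delta>) = 0" using F arg(1)[of s] unfolding smooth_step_def by blast
    then show "G j s = 0" by (simp add: G_def)
  qed
  then show ?thesis by blast
qed

text \<open>The derivatives vanish on the left of \<open>a\<close>, so an exponential weight of any rate \<open>h \<ge> 0\<close> is free. Taking
  \<open>h\<close> near the level \<open>a\<close> is what makes the replacement errors small relative to \<open>exp (- a\<^sup>2 / 2)\<close>.\<close>
lemma smooth_step_derivative_bound:
  assumes F: "smooth_step a \<delta> F" and \<delta>: "0 < \<delta>" and j: "j \<in> {1..3}" and h: "0 \<le> h"
  shows "\<bar>F j s\<bar> \<le> 840 / \<delta> ^ 3 * exp (h * (s - a))"
proof (cases "s \<le> a")
  case True
  then show ?thesis using F j \<delta> by (auto simp: smooth_step_def)
next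
  case False
  then have "1 \<le> exp (h * (s - a))" using h by simp
  then have "840 / \<delta> ^ 3 * 1 \<le> 840 / \<delta> ^ 3 * exp (h * (s - a))"
    using \<delta> by (intro mult_left_mono) auto
  moreover have "\<bar>F j s\<bar> \<le> 840 / \<delta> ^ 3" using F j by (simp add: smooth_step_def)
  ultimately show ?thesis by linarith
qed

lemma smooth_step_borel_measurable:
  assumes F: "smooth_step a \<delta> F" and j: "j < 3"
  shows "F j \<in> borel_measurable borel"
proof (rule borel_measurable_continuous_onI, rule continuous_at_imp_continuous_on, rule ballI)
  fix s show "isCont (F j) s"
    by (rule DERIV_isCont[of _ "F (Suc j) s"]) (use F j in \<open>simp add: smooth_step_def\<close>)
qed

text \<open>The intermediate point of the Lagrange remainder is at most r + |v|. Hence the weight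
  splits into a factor in \<open>r\<close> and a factor in \<open>v\<close>, the form in which
  independence can be used later.\<close>

lemma taylor2_exp_bound:
  fixes F :: "nat \<Rightarrow> real \<Rightarrow> real"
  assumes d: "\<And>j s. j < 3 \<Longrightarrow> (F j has_real_derivative F (Suc j) s) (at s)"
    and b: "\<And>s. \<bar>F 3 s\<bar> \<le> K * exp (h * s)" and h: "0 \<le> h"
  shows "\<bar>F 0 (r + v) - (F 0 r + F 1 r * v + F 2 r * v\<^sup>2 / 2)\<bar> \<le> K * exp (h * r) * (\<bar>v\<bar> ^ 3 * exp (h * \<bar>v\<bar>))"
proof (cases "v = 0")
  case False
  have "\<exists>t. (if r + v < r then r + v < t \<and> t < r else r < t \<and> t < r + v) \<and>
    F 0 (r + v) = (\<Sum>m<3. (F m r / fact m) * ((r + v) - r)^m) + (F 3 t / fact 3) * ((r + v) - r)^3"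
    by (rule Taylor[of 3 F "F 0" "min r (r+v)" "max r (r + v)"]) (use d False in auto)
  then obtain t where "if r + v < r then r + v < t \<and> t < r else r < t \<and> t < r + v"
    and e: "F 0 (r + v) = (\<Sum>m<3. (F m r / fact m) * v^m) + (F 3 t / fact 3) * v^3"
    by auto
  then have t: "t \<le> r + \<bar>v\<bar>" by (auto split: if_splits)
  have K: "0 \<le> K" using b[of 0] by auto
  have "F 0 (r + v) - (F 0 r + F 1 r * v + F 2 r * v\<^sup>2 / 2) = F 3 t * v ^ 3 / 6"
    unfolding e by (simp add: numeral_eq_Suc algebra_simps)
  also have "\<bar>\<dots>\<bar> \<le> \<bar>F 3 t\<bar> * \<bar>v\<bar> ^ 3"
    by (simp add: abs_mult power_abs)
  also have "\<dots> \<le> (K * exp (h * t)) * \<bar>v\<bar> ^ 3" using b by (intro mult_right_mono) auto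
  also have "\<dots> \<le> (K * exp (h * (r + \<bar>v\<bar>))) * \<bar>v\<bar> ^ 3"
    using t h K by (intro mult_right_mono mult_left_mono) (auto intro: mult_left_mono)
  finally show ?thesis by (simp add: exp_add algebra_simps)
qed simp

section \<open>Lindeberg replacement with exponential weights\<close>

text \<open>The rate \<open>c\<close> ranges over all reals, so both tails are controlled. Truncated
  summands and normal variables both belong to this class.\<close>

definition exp_moments :: "'a measure \<Rightarrow> ('a \<Rightarrow> real) \<Rightarrow> bool" where
  "exp_moments M V \<longleftrightarrow> V \<in> borel_measurable M \<and> (\<forall>c. integrable M (\<lambda>\<omega>. exp (c * V \<omega>)))"

lemma exp_moments_integrable:
  assumes V: "exp_moments M V" and g: "g \<in> borel_measurable borel"
    and b: "\<And>v. \<bar>g v\<bar> \<le> A * exp (c * \<bar>v\<bar>)"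
  shows "integrable M (\<lambda>\<omega>. g (V \<omega>) :: real)"
proof (rule Bochner_Integration.integrable_bound)
  show "integrable M (\<lambda>\<omega>. \<bar>A\<bar> * (exp (c * V \<omega>) + exp ((-c) * V \<omega>)))"
    using V unfolding exp_moments_def by (intro integrable_mult_right Bochner_Integration.integrable_add) blast+
  show "(\<lambda>\<omega>. g (V \<omega>)) \<in> borel_measurable M"
    using V g unfolding exp_moments_def by (auto intro: measurable_compose)
  have "norm (g v) \<le> norm (\<bar>A\<bar> * (exp (c * v) + exp ((-c) * v)))" for v
  proof -
    have "\<bar>g v\<bar> \<le> \<bar>A\<bar> * exp (c * \<bar>v\<bar>)" by (rule order_trans[OF b mult_right_mono[OF abs_ge_self]]) simp
    also have "exp (c * \<bar>v\<bar>) \<le> exp (c * v) + exp ((-c) * v)" by (auto simp: abs_if)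
    finally show ?thesis by (simp add: mult_left_mono)
  qed
  then show "AE \<omega> in M. norm (g (V \<omega>)) \<le> norm (\<bar>A\<bar> * (exp (c * V \<omega>) + exp ((-c) * V \<omega>)))" by simp
qed

lemma exp_ge_power_div_fact:
  assumes "0 \<le> (t::real)" shows "t ^ k / fact k \<le> exp t"
proof -
  have "(\<Sum>i\<in>{k}. t ^ i /\<^sub>R fact i) \<le> (\<Sum>i. t ^ i /\<^sub>R fact i)"
    using assms by (intro sum_le_suminf summable_exp_generic) auto
  then show ?thesis by (simp add: exp_def field_simps)
qed

lemma exp_moments_integrable_cube:
  assumes V: "exp_moments M V"
  shows "integrable M (\<lambda>\<omega>. \<bar>V \<omega>\<bar> ^ 3 * exp (h * \<bar>V \<omega>\<bar>))"
proof (rule exp_moments_integrable[OF V, where A=6 and c="1 + h"])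
  fix v :: real
  have "\<bar>v\<bar> ^ 3 * exp (h * \<bar>v\<bar>) \<le> 6 * exp \<bar>v\<bar> * exp (h * \<bar>v\<bar>)"
    using exp_ge_power_div_fact[of "\<bar>v\<bar>" 3] by (intro mult_right_mono) (auto simp: fact_numeral)
  also have "\<dots> = 6 * exp ((1 + h) * \<bar>v\<bar>)" by (simp add: exp_add distrib_right)
  finally show "\<bar>\<bar>v\<bar> ^ 3 * exp (h * \<bar>v\<bar>)\<bar> \<le> 6 * exp ((1 + h) * \<bar>v\<bar>)"
    by simp
qed simp

lemma exp_moments_integrable_power:
  assumes V: "exp_moments M V"
  shows "integrable M (\<lambda>\<omega>. V \<omega>)" "integrable M (\<lambda>\<omega>. (V \<omega>)\<^sup>2)"
proof -
  have e: "1 + \<bar>v\<bar> \<le> exp \<bar>v\<bar>" for v :: real by (rule exp_ge_add_one_self)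
  show "integrable M (\<lambda>\<omega>. V \<omega>)"
  proof (rule exp_moments_integrable[OF V, where A=1 and c=1])
    fix v :: real show "\<bar>v\<bar> \<le> 1 * exp (1 * \<bar>v\<bar>)" using e[of v] by (simp only: mult_1)
  qed simp
  have "v\<^sup>2 \<le> exp (2 * \<bar>v\<bar>)" for v :: real
  proof -
    have "\<bar>v\<bar> \<le> exp \<bar>v\<bar>" using e[of v] by linarith
    then have "\<bar>v\<bar>\<^sup>2 \<le> (exp \<bar>v\<bar>)\<^sup>2" by (intro power_mono) auto
    then show ?thesis by (simp add: exp_double)
  qed
  then show "integrable M (\<lambda>\<omega>. (V \<omega>)\<^sup>2)"
    by (intro exp_moments_integrable[OF V, where A=1 and c=2]) auto
qed

text \<open>Here \<open>s\<close> is the target standard deviation, \<open>b\<close> the tolerated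
  bias of the first two moments, which truncation makes necessary, and \<open>q\<close> the budget
  for the exponentially weighted third moment. Truncated and normal variables are thus treated
  alike.\<close>

definition near_moments :: "'a measure \<Rightarrow> real \<Rightarrow> real \<Rightarrow> real \<Rightarrow> real \<Rightarrow> ('a \<Rightarrow> real) \<Rightarrow> bool" where
  "near_moments M h s b q V \<longleftrightarrow> exp_moments M V \<and>
     \<bar>\<integral>\<omega>. V \<omega> \<partial>M\<bar> \<le> b \<and> \<bar>(\<integral>\<omega>. (V \<omega>)\<^sup>2 \<partial>M) - s\<^sup>2\<bar> \<le> b \<and>
     (\<integral>\<omega>. \<bar>V \<omega>\<bar> ^ 3 * exp (h * \<bar>V \<omega>\<bar>) \<partial>M) \<le> q"

context prob_space
begin

text \<open>Expand to second order, take expectations and apply 1 + u \<le> exp u. The exponential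
  form turns products over independent summands into sums of exponents. The crude factor
  \<open>(1 + h) ^ 3\<close> covers both h + h^2/2 and h^3.\<close>

lemma exp_moment_bound:
  assumes V: "near_moments M h s b q V" and h: "0 \<le> h"
  shows "expectation (\<lambda>\<omega>. exp (h * V \<omega>)) \<le> exp (h\<^sup>2 * s\<^sup>2 / 2 + (1 + h) ^ 3 * (b + q))"
proof -
  have em: "exp_moments M V" and b: "\<bar>expectation V\<bar> \<le> b" "\<bar>expectation (\<lambda>\<omega>. (V \<omega>)\<^sup>2) - s\<^sup>2\<bar> \<le> b"
    and q: "expectation (\<lambda>\<omega>. \<bar>V \<omega>\<bar> ^ 3 * exp (h * \<bar>V \<omega>\<bar>)) \<le> q"
    using V by (auto simp: near_moments_def)
  have q0: "0 \<le> q" by (rule order_trans[OF _ q]) (auto intro!: integral_nonneg_AE)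
  have i: "integrable M (\<lambda>\<omega>. exp (h * V \<omega>))" using em by (simp add: exp_moments_def)
  note p = exp_moments_integrable_power[OF em] exp_moments_integrable_cube[OF em, of h]
  \<comment> \<open>Taylor bound at 0 for the successive derivatives
    \<open>h ^ j * exp (h * s)\<close> of the exponential.\<close>
  have "exp (h * v) \<le> 1 + h * v + h\<^sup>2 * v\<^sup>2 / 2 + h ^ 3 * (\<bar>v\<bar> ^ 3 * exp (h * \<bar>v\<bar>))" for v
    using taylor2_exp_bound[of "\<lambda>j s. h ^ j * exp (h * s)" "h ^ 3" h 0 v] h
    by (force intro!: derivative_eq_intros simp: power2_eq_square)
  then have "expectation (\<lambda>\<omega>. exp (h * V \<omega>)) \<le>
      expectation (\<lambda>\<omega>. 1 + h * V \<omega> + h\<^sup>2 * (V \<omega>)\<^sup>2 / 2 + h ^ 3 * (\<bar>V \<omega>\<bar> ^ 3 * exp (h * \<bar>V \<omega>\<bar>)))"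
    using i p by (intro integral_mono) auto
  also have "\<dots> = 1 + h * expectation V + h\<^sup>2 * expectation (\<lambda>\<omega>. (V \<omega>)\<^sup>2) / 2 +
      h ^ 3 * expectation (\<lambda>\<omega>. \<bar>V \<omega>\<bar> ^ 3 * exp (h * \<bar>V \<omega>\<bar>))"
    using p by (simp add: prob_space)
  also have "\<dots> \<le> 1 + h * b + h\<^sup>2 * (s\<^sup>2 + b) / 2 + h ^ 3 * q"
    using b q h by (intro add_mono divide_right_mono mult_left_mono) auto
  also have "\<dots> = 1 + h\<^sup>2 * s\<^sup>2 / 2 + (h + h\<^sup>2 / 2) * b + h ^ 3 * q" by (simp add: field_simps)
  also have "\<dots> \<le> 1 + h\<^sup>2 * s\<^sup>2 / 2 + (1 + h) ^ 3 * b + (1 + h) ^ 3 * q"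
    using h b(1) q0 by (intro add_mono mult_right_mono) (auto simp: eval_nat_numeral field_simps)
  also have "\<dots> \<le> exp (h\<^sup>2 * s\<^sup>2 / 2 + (1 + h) ^ 3 * (b + q))"
    using exp_ge_add_one_self[of "h\<^sup>2 * s\<^sup>2 / 2 + (1 + h) ^ 3 * (b + q)"] by (simp add: algebra_simps)
  finally show ?thesis .
qed

text \<open>Expand \<open>F 0\<close> around the independent rest \<open>R\<close>. The main term
  depends on \<open>V\<close> only through \<open>s\<close>, so it cancels when two variables with
  the same \<open>s\<close> are exchanged. The biases of the two moments cost \<open>b\<close> each
  and the Taylor remainder costs \<open>q\<close>.\<close>

lemma lindeberg_step:
  assumes V: "near_moments M h s b q V" and h: "0 \<le> h"
    and ind: "indep_var borel V borel R"
    and R: "integrable M (\<lambda>\<omega>. exp (h * R \<omega>))"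
    and F: "smooth_step a \<delta> F" and \<delta>: "0 < \<delta>"
  shows "\<bar>expectation (\<lambda>\<omega>. F 0 (V \<omega> + R \<omega>)) - (expectation (\<lambda>\<omega>. F 0 (R \<omega>)) + s\<^sup>2 / 2 * expectation (\<lambda>\<omega>. F 2 (R \<omega>)))\<bar>
    \<le> 840 / \<delta> ^ 3 * exp (- h * a) * expectation (\<lambda>\<omega>. exp (h * R \<omega>)) * (2 * b + q)"
proof -
  have em: "exp_moments M V" and b: "\<bar>expectation V\<bar> \<le> b" "\<bar>expectation (\<lambda>\<omega>. (V \<omega>)\<^sup>2) - s\<^sup>2\<bar> \<le> b"
    and q: "expectation (\<lambda>\<omega>. \<bar>V \<omega>\<bar> ^ 3 * exp (h * \<bar>V \<omega>\<bar>)) \<le> q"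
    using V by (auto simp: near_moments_def)
  note p = exp_moments_integrable_power[OF em] exp_moments_integrable_cube[OF em, of h]
  have [measurable]: "V \<in> borel_measurable M" "R \<in> borel_measurable M"
    using ind by (auto dest: indep_var_rv1 indep_var_rv2)
  define K where "K = 840 / \<delta> ^ 3 * exp (- h * a)"
  have K0: "0 \<le> K" using \<delta> by (simp add: K_def)
  define m where "m = expectation (\<lambda>\<omega>. exp (h * R \<omega>))"
  have m0: "0 \<le> m" unfolding m_def by (intro integral_nonneg_AE) auto
  have d: "(F j has_real_derivative F (Suc j) t) (at t)" if "j < 3" for j t
    using F that by (simp add: smooth_step_def)
  have "exp (h * (t - a)) = exp (- h * a) * exp (h * t)" for t
    by (subst exp_add[symmetric]) (simp add: algebra_simps)
  then have FK: "\<bar>F j t\<bar> \<le> K * exp (h * t)" if "j \<in> {1..3}" for j t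
    using smooth_step_derivative_bound[OF F \<delta> that h, of t] by (simp only: K_def mult.assoc)
  have [measurable]: "F 0 \<in> borel_measurable borel" "F (Suc 0) \<in> borel_measurable borel" "F 2 \<in> borel_measurable borel"
    by (auto intro: smooth_step_borel_measurable[OF F])
  have F0: "\<bar>F 0 t\<bar> \<le> 1" for t using F by (simp add: smooth_step_def)
  have iF: "integrable M (\<lambda>\<omega>. F j (R \<omega>))" if "j = 1 \<or> j = 2" for j
  proof (rule Bochner_Integration.integrable_bound)
    show "integrable M (\<lambda>\<omega>. K * exp (h * R \<omega>))" using R by simp
    show "AE \<omega> in M. norm (F j (R \<omega>)) \<le> norm (K * exp (h * R \<omega>))"
      using FK[of j] that K0 by auto
  qed (use that in auto)
  have i0: "integrable M (\<lambda>\<omega>. F 0 (R \<omega>))" "integrable M (\<lambda>\<omega>. F 0 (V \<omega> + R \<omega>))"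
    by (rule integrable_const_bound[where B=1]; use F0 in simp)+
  \<comment> \<open>Independence separates the weight in \<open>R\<close> from the moments of
    \<open>V\<close>. It is used for the linear, the quadratic and the remainder term.\<close>
  have fac: "integrable M (\<lambda>\<omega>. g (R \<omega>) * g' (V \<omega>)) \<and>
      expectation (\<lambda>\<omega>. g (R \<omega>) * g' (V \<omega>)) = expectation (\<lambda>\<omega>. g (R \<omega>)) * expectation (\<lambda>\<omega>. g' (V \<omega>))"
    if m: "g \<in> borel_measurable borel" "g' \<in> borel_measurable borel"
      and i: "integrable M (\<lambda>\<omega>. g (R \<omega>))" "integrable M (\<lambda>\<omega>. g' (V \<omega>))" for g g' :: "real \<Rightarrow> real"
  proof -
    have "indep_var borel (\<lambda>\<omega>. g' (V \<omega>)) borel (\<lambda>\<omega>. g (R \<omega>))"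
      using indep_var_compose[OF ind m(2) m(1)] by (simp add: comp_def)
    from indep_var_integrable[OF this i(2,1)] indep_var_lebesgue_integral[OF this i(2,1)]
    show ?thesis by (simp only: mult.commute[of "g' _"] mult.commute[of "expectation (\<lambda>\<omega>. g' (V \<omega>))"] simp_thms)
  qed
  have mF: "F 1 \<in> borel_measurable borel" "F 2 \<in> borel_measurable borel"
      "(\<lambda>t. exp (h * t)) \<in> borel_measurable borel"
    and mg: "(\<lambda>v::real. v) \<in> borel_measurable borel" "(\<lambda>v::real. v\<^sup>2) \<in> borel_measurable borel"
      "(\<lambda>v::real. \<bar>v\<bar> ^ 3 * exp (h * \<bar>v\<bar>)) \<in> borel_measurable borel"
    by simp_all
  note f1 = fac[OF mF(1) mg(1) iF[of 1] p(1)]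
    and f2 = fac[OF mF(2) mg(2) iF[of 2] p(2)] and f3 = fac[OF mF(3) mg(3) R p(3)]
  have e1: "integrable M (\<lambda>\<omega>. F 1 (R \<omega>) * V \<omega>)"
      "expectation (\<lambda>\<omega>. F 1 (R \<omega>) * V \<omega>) = expectation (\<lambda>\<omega>. F 1 (R \<omega>)) * expectation V"
    using f1 by blast+
  have e2: "integrable M (\<lambda>\<omega>. F 2 (R \<omega>) * (V \<omega>)\<^sup>2)"
      "expectation (\<lambda>\<omega>. F 2 (R \<omega>) * (V \<omega>)\<^sup>2) = expectation (\<lambda>\<omega>. F 2 (R \<omega>)) * expectation (\<lambda>\<omega>. (V \<omega>)\<^sup>2)"
    using f2 by blast+
  have e3: "integrable M (\<lambda>\<omega>. exp (h * R \<omega>) * (\<bar>V \<omega>\<bar> ^ 3 * exp (h * \<bar>V \<omega>\<bar>)))"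
      "expectation (\<lambda>\<omega>. exp (h * R \<omega>) * (\<bar>V \<omega>\<bar> ^ 3 * exp (h * \<bar>V \<omega>\<bar>))) =
        m * expectation (\<lambda>\<omega>. \<bar>V \<omega>\<bar> ^ 3 * exp (h * \<bar>V \<omega>\<bar>))"
    using f3 unfolding m_def by blast+
  have Fm: "\<bar>expectation (\<lambda>\<omega>. F j (R \<omega>))\<bar> \<le> K * m" if "j = 1 \<or> j = 2" for j
  proof -
    have "\<bar>expectation (\<lambda>\<omega>. F j (R \<omega>))\<bar> \<le> expectation (\<lambda>\<omega>. \<bar>F j (R \<omega>)\<bar>)"
      using integral_norm_bound[of M "\<lambda>\<omega>. F j (R \<omega>)"] by simp
    also have "\<dots> \<le> expectation (\<lambda>\<omega>. K * exp (h * R \<omega>))"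
      using iF[OF that] R FK[of j] that by (intro integral_mono) auto
    finally show ?thesis by (simp add: m_def)
  qed
  define G where "G \<omega> = F 0 (V \<omega> + R \<omega>) - (F 0 (R \<omega>) + F 1 (R \<omega>) * V \<omega> + F 2 (R \<omega>) * (V \<omega>)\<^sup>2 / 2)" for \<omega>
  have iG: "integrable M G" unfolding G_def using i0 e1 e2 by auto
  have "\<bar>G \<omega>\<bar> \<le> K * (exp (h * R \<omega>) * (\<bar>V \<omega>\<bar> ^ 3 * exp (h * \<bar>V \<omega>\<bar>)))" for \<omega>
    using taylor2_exp_bound[of F K h "R \<omega>" "V \<omega>"] d FK[of 3] h by (simp add: G_def add.commute mult.assoc)
  then have "expectation (\<lambda>\<omega>. \<bar>G \<omega>\<bar>) \<le> expectation (\<lambda>\<omega>. K * (exp (h * R \<omega>) * (\<bar>V \<omega>\<bar> ^ 3 * exp (h * \<bar>V \<omega>\<bar>))))"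
    using iG e3 by (intro integral_mono) auto
  also have "\<dots> \<le> K * m * q" using e3 q m0 K0 by (simp add: mult_left_mono mult.assoc)
  finally have G: "\<bar>expectation G\<bar> \<le> K * m * q"
    using integral_abs_bound[of M G] by linarith
  have eG: "expectation G = expectation (\<lambda>\<omega>. F 0 (V \<omega> + R \<omega>)) - (expectation (\<lambda>\<omega>. F 0 (R \<omega>)) +
      expectation (\<lambda>\<omega>. F 1 (R \<omega>)) * expectation V + expectation (\<lambda>\<omega>. F 2 (R \<omega>)) * expectation (\<lambda>\<omega>. (V \<omega>)\<^sup>2) / 2)"
    unfolding G_def using i0 e1 e2 by simp
  \<comment> \<open>Three errors remain: the Taylor remainder, the nonzero mean of \<open>V\<close>,
    and the deviation of its second moment from the square of \<open>s\<close>.\<close>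
  have "expectation (\<lambda>\<omega>. F 0 (V \<omega> + R \<omega>)) - (expectation (\<lambda>\<omega>. F 0 (R \<omega>)) + s\<^sup>2 / 2 * expectation (\<lambda>\<omega>. F 2 (R \<omega>))) =
    expectation G + expectation (\<lambda>\<omega>. F 1 (R \<omega>)) * expectation V +
    expectation (\<lambda>\<omega>. F 2 (R \<omega>)) * ((expectation (\<lambda>\<omega>. (V \<omega>)\<^sup>2) - s\<^sup>2) / 2)"
    unfolding eG by (simp add: field_simps)
  also have "\<bar>\<dots>\<bar> \<le> K * m * q + K * m * b + K * m * b"
  proof (intro order_trans[OF abs_triangle_ineq] add_mono G)
    show "\<bar>expectation (\<lambda>\<omega>. F 1 (R \<omega>)) * expectation V\<bar> \<le> K * m * b"
      unfolding abs_mult using Fm[of 1] b K0 m0 by (intro mult_mono) auto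
    show "\<bar>expectation (\<lambda>\<omega>. F 2 (R \<omega>)) * ((expectation (\<lambda>\<omega>. (V \<omega>)\<^sup>2) - s\<^sup>2) / 2)\<bar> \<le> K * m * b"
      unfolding abs_mult using Fm[of 2] b K0 m0 by (intro mult_mono) auto
  qed
  also have "\<dots> = K * m * (2 * b + q)" by (simp add: algebra_simps)
  finally show ?thesis by (simp add: K_def m_def)
qed

lemma exp_moment_sum_bound:
  assumes J: "finite J" "indep_vars (\<lambda>_. borel) V J"
    and em: "\<And>j. j \<in> J \<Longrightarrow> near_moments M h (s j) (b j) (q j) (V j)" and h: "0 \<le> h"
  shows "integrable M (\<lambda>\<omega>. exp (h * (\<Sum>j\<in>J. V j \<omega>)))"
    and "expectation (\<lambda>\<omega>. exp (h * (\<Sum>j\<in>J. V j \<omega>))) \<le> exp (\<Sum>j\<in>J. h\<^sup>2 * (s j)\<^sup>2 / 2 + (1 + h) ^ 3 * (b j + q j))"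
proof -
  have e: "(\<lambda>\<omega>. exp (h * (\<Sum>j\<in>J. V j \<omega>))) = (\<lambda>\<omega>. \<Prod>j\<in>J. exp (h * V j \<omega>))"
    using J(1) by (simp add: sum_distrib_left exp_sum)
  have ind: "indep_vars (\<lambda>_. borel) (\<lambda>j \<omega>. exp (h * V j \<omega>)) J"
    by (rule indep_vars_compose2[OF J(2)]) auto
  have i: "integrable M (\<lambda>\<omega>. exp (h * V j \<omega>))" if "j \<in> J" for j
    using em[OF that] by (auto simp: near_moments_def exp_moments_def)
  show "integrable M (\<lambda>\<omega>. exp (h * (\<Sum>j\<in>J. V j \<omega>)))"
    unfolding e by (rule indep_vars_integrable[OF J(1) ind i])
  have "expectation (\<lambda>\<omega>. exp (h * (\<Sum>j\<in>J. V j \<omega>))) = (\<Prod>j\<in>J. expectation (\<lambda>\<omega>. exp (h * V j \<omega>)))"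
    unfolding e by (rule indep_vars_lebesgue_integral[OF J(1) ind i])
  also have "\<dots> \<le> (\<Prod>j\<in>J. exp (h\<^sup>2 * (s j)\<^sup>2 / 2 + (1 + h) ^ 3 * (b j + q j)))"
    using exp_moment_bound[OF em h] by (intro prod_mono) (auto intro!: integral_nonneg_AE)
  finally show "expectation (\<lambda>\<omega>. exp (h * (\<Sum>j\<in>J. V j \<omega>))) \<le> exp (\<Sum>j\<in>J. h\<^sup>2 * (s j)\<^sup>2 / 2 + (1 + h) ^ 3 * (b j + q j))"
    using J(1) by (simp add: exp_sum)
qed

text \<open>The Boolean in the index selects one of two families, all of whose members are jointly
  independent. Both families share the data \<open>s\<close>, \<open>b\<close>, \<open>q\<close>, so
  each exchange costs two errors of \<open>lindeberg_step\<close>, which gives the factor 2 in the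
  last sum.\<close>

lemma lindeberg_replacement:
  fixes V :: "'i \<times> bool \<Rightarrow> 'a \<Rightarrow> real"
  assumes I: "finite I" and ind: "indep_vars (\<lambda>_. borel) V (I \<times> UNIV)"
    and nm: "\<And>i \<beta>. i \<in> I \<Longrightarrow> near_moments M h (s i) (b i) (q i) (V (i, \<beta>))" and h: "0 \<le> h"
    and F: "smooth_step a \<delta> F" and \<delta>: "0 < \<delta>"
  shows "\<bar>expectation (\<lambda>\<omega>. F 0 (\<Sum>i\<in>I. V (i, True) \<omega>)) - expectation (\<lambda>\<omega>. F 0 (\<Sum>i\<in>I. V (i, False) \<omega>))\<bar>
    \<le> 840 / \<delta> ^ 3 * exp (- h * a) * exp (\<Sum>i\<in>I. h\<^sup>2 * (s i)\<^sup>2 / 2 + (1 + h) ^ 3 * (b i + q i)) *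
        (\<Sum>i\<in>I. 2 * (2 * b i + q i))"
proof -
  define T where "T A = expectation (\<lambda>\<omega>. F 0 (\<Sum>i\<in>I. V (i, i \<in> A) \<omega>))" for A
  define C where "C = 840 / \<delta> ^ 3 * exp (- h * a) * exp (\<Sum>i\<in>I. h\<^sup>2 * (s i)\<^sup>2 / 2 + (1 + h) ^ 3 * (b i + q i))"
  have bq: "0 \<le> b i" "0 \<le> q i" if "i \<in> I" for i
  proof -
    show "0 \<le> b i" using nm[OF that, of True] by (auto simp: near_moments_def)
    have "0 \<le> expectation (\<lambda>\<omega>. \<bar>V (i, True) \<omega>\<bar> ^ 3 * exp (h * \<bar>V (i, True) \<omega>\<bar>))"
      by (intro integral_nonneg_AE) auto
    also have "\<dots> \<le> q i" using nm[OF that, of True] by (auto simp: near_moments_def)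
    finally show "0 \<le> q i" .
  qed
  \<comment> \<open>Hybrid argument: \<open>A\<close> is the set of indices that still carry the \<open>True\<close> variables.\<close>
  have "\<bar>T A - T {}\<bar> \<le> C * (\<Sum>i\<in>A. 2 * (2 * b i + q i))" if "A \<subseteq> I" for A
    using finite_subset[OF that I] that
  proof (induction A rule: finite_induct)
    case (insert x A)
    then have x: "x \<in> I" by auto
    \<comment> \<open>The summands other than \<open>x\<close> are the same in the hybrids for
      \<open>A\<close> and for \<open>insert x A\<close>; their sum is the rest
      \<open>R\<close>.\<close>
    define J where "J = (\<lambda>i. (i, i \<in> A)) ` (I - {x})"
    define R where "R \<omega> = (\<Sum>j\<in>J. V j \<omega>)" for \<omega>
    have inj: "inj_on (\<lambda>i. (i, i \<in> A)) (I - {x})" by (auto simp: inj_on_def)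
    have J: "finite J" "J \<subseteq> I \<times> UNIV" "\<And>\<beta>. (x, \<beta>) \<notin> J" using I by (auto simp: J_def)
    have R: "R \<omega> = (\<Sum>i\<in>I - {x}. V (i, i \<in> A) \<omega>)" for \<omega>
      unfolding R_def J_def by (subst sum.reindex[OF inj]) simp
    have T1: "T A = expectation (\<lambda>\<omega>. F 0 (V (x, False) \<omega> + R \<omega>))"
      unfolding T_def R using insert(2) by (subst sum.remove[OF I x]) auto
    have "(\<Sum>i\<in>I - {x}. V (i, i \<in> insert x A) \<omega>) = R \<omega>" for \<omega>
      unfolding R by (intro sum.cong) auto
    then have T2: "T (insert x A) = expectation (\<lambda>\<omega>. F 0 (V (x, True) \<omega> + R \<omega>))"
      unfolding T_def by (subst sum.remove[OF I x]) auto
    have indR: "indep_var borel (V (x, \<beta>)) borel R" for \<beta>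
      unfolding R_def using J x by (intro indep_vars_sum indep_vars_subset[OF ind]) auto
    have nmJ: "near_moments M h (s (fst j)) (b (fst j)) (q (fst j)) (V j)" if "j \<in> J" for j
      using nm[of "fst j" "snd j"] J that by auto
    note mR = exp_moment_sum_bound[OF J(1) indep_vars_subset[OF ind J(2)] nmJ h, folded R_def]
    have "expectation (\<lambda>\<omega>. exp (h * R \<omega>)) \<le> exp (\<Sum>j\<in>J. h\<^sup>2 * (s (fst j))\<^sup>2 / 2 + (1 + h) ^ 3 * (b (fst j) + q (fst j)))"
      by (rule mR(2))
    also have "(\<Sum>j\<in>J. h\<^sup>2 * (s (fst j))\<^sup>2 / 2 + (1 + h) ^ 3 * (b (fst j) + q (fst j))) =
        (\<Sum>i\<in>I - {x}. h\<^sup>2 * (s i)\<^sup>2 / 2 + (1 + h) ^ 3 * (b i + q i))"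
      unfolding J_def by (subst sum.reindex[OF inj]) simp
    \<comment> \<open>Adding the nonnegative exponent of the omitted summand makes the bound the
      same for every exchange.\<close>
    also have "\<dots> \<le> (\<Sum>i\<in>I. h\<^sup>2 * (s i)\<^sup>2 / 2 + (1 + h) ^ 3 * (b i + q i))"
      using I bq h by (intro sum_mono2) auto
    finally have mRI: "expectation (\<lambda>\<omega>. exp (h * R \<omega>)) \<le> exp (\<Sum>i\<in>I. h\<^sup>2 * (s i)\<^sup>2 / 2 + (1 + h) ^ 3 * (b i + q i))"
      by simp
    have st: "\<bar>expectation (\<lambda>\<omega>. F 0 (V (x, \<beta>) \<omega> + R \<omega>)) - (expectation (\<lambda>\<omega>. F 0 (R \<omega>)) + (s x)\<^sup>2 / 2 * expectation (\<lambda>\<omega>. F 2 (R \<omega>)))\<bar>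
      \<le> C * (2 * b x + q x)" for \<beta>
    proof (rule order_trans[OF lindeberg_step[OF nm[OF x] h indR mR(1) F \<delta>]])
      show "840 / \<delta> ^ 3 * exp (- h * a) * expectation (\<lambda>\<omega>. exp (h * R \<omega>)) * (2 * b x + q x) \<le> C * (2 * b x + q x)"
        unfolding C_def using mRI \<delta> bq[OF x] by (intro mult_right_mono mult_left_mono) auto
    qed
    have "\<bar>T (insert x A) - T A\<bar> \<le> C * (2 * (2 * b x + q x))"
      using st[of True] st[of False] unfolding T1 T2 mult.left_commute[of C 2] by linarith
    moreover have "\<bar>T A - T {}\<bar> \<le> C * (\<Sum>i\<in>A. 2 * (2 * b i + q i))" using insert by auto
    ultimately show ?case using insert(1,2) by (simp add: distrib_left)
  qed simp
  from this[of I] show ?thesis by (simp add: T_def C_def)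
qed

end

section \<open>Comparison with the normal law\<close>

lemma near_moments_mono:
  "near_moments M h s b q V \<Longrightarrow> b \<le> b' \<Longrightarrow> q \<le> q' \<Longrightarrow> near_moments M h s b' q' V"
  by (auto simp: near_moments_def)

context prob_space
begin

text \<open>Completing the square: tilting the density by exp(c x) shifts its mean to c s^2 and
  leaves the constant exp(c^2 s^2 / 2).\<close>

lemma normal_exp_moment:
  assumes Z: "distributed M lborel Z (normal_density 0 s)" and s: "0 < s"
  shows "integrable M (\<lambda>\<omega>. exp (c * Z \<omega>))"
    and "expectation (\<lambda>\<omega>. exp (c * Z \<omega>)) = exp (c\<^sup>2 * s\<^sup>2 / 2)"
proof -
  have "exp (- (x - 0)\<^sup>2 / (2 * s\<^sup>2)) * exp (c * x) = exp (c\<^sup>2 * s\<^sup>2 / 2) * exp (- (x - c * s\<^sup>2)\<^sup>2 / (2 * s\<^sup>2))" for x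
    unfolding exp_add[symmetric] using s
    by (intro arg_cong[where f=exp]) (simp add: field_simps power2_eq_square)
  then have e: "normal_density 0 s x * exp (c * x) = exp (c\<^sup>2 * s\<^sup>2 / 2) * normal_density (c * s\<^sup>2) s x" for x
    unfolding normal_density_def by (metis (no_types, lifting) mult.assoc mult.left_commute)
  show "integrable M (\<lambda>\<omega>. exp (c * Z \<omega>))"
    using distributed_integrable[OF Z, of "\<lambda>x. exp (c * x)"] s by (simp add: e)
  show "expectation (\<lambda>\<omega>. exp (c * Z \<omega>)) = exp (c\<^sup>2 * s\<^sup>2 / 2)"
    using distributed_integral[OF Z, of "\<lambda>x. exp (c * x)"] s by (simp add: e)
qed

text \<open>Put u = |z|/s. Then u^3 \<le> 6 exp u, and h s \<le> 1 gives exp(h |z|) \<le> exp u, so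
  the integrand is at most 6 s^3 exp(2u). Each of exp(2z/s) and exp(-2z/s) has mean exp 2, whence
  the constant 12 exp 2.\<close>

lemma near_moments_normal:
  assumes Z: "distributed M lborel Z (normal_density 0 s)" and s: "0 < s" and h: "h * s \<le> 1"
  shows "near_moments M h s 0 (12 * exp 2 * s ^ 3) Z"
  unfolding near_moments_def
proof (intro conjI)
  have [measurable]: "Z \<in> borel_measurable M" using Z by (simp add: distributed_def)
  show em: "exp_moments M Z"
    unfolding exp_moments_def using normal_exp_moment(1)[OF Z s] by simp
  show "\<bar>expectation Z\<bar> \<le> 0"
    using distributed_integral[OF Z, of "\<lambda>x. x"] integral_normal_moment_nz_1[OF s, of 0] by simp
  show "\<bar>expectation (\<lambda>\<omega>. (Z \<omega>)\<^sup>2) - s\<^sup>2\<bar> \<le> 0"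
    using distributed_integral[OF Z, of "\<lambda>x. x\<^sup>2"] integral_normal_moment_even[OF s, of 0 1] by (simp add: fact_numeral)
  have pt: "\<bar>z\<bar> ^ 3 * exp (h * \<bar>z\<bar>) \<le> 6 * s ^ 3 * (exp (2 / s * z) + exp ((- 2 / s) * z))" for z
  proof -
    define u where "u = \<bar>z\<bar> / s"
    have u: "0 \<le> u" "\<bar>z\<bar> = s * u" using s by (auto simp: u_def)
    have "h * \<bar>z\<bar> = (h * s) * u" using u by simp
    also have "\<dots> \<le> u" using mult_right_mono[OF h u(1)] by simp
    finally have "exp (h * \<bar>z\<bar>) \<le> exp u" by simp
    moreover have "u ^ 3 \<le> 6 * exp u" using exp_ge_power_div_fact[of u 3] u by (simp add: fact_numeral)
    ultimately have "u ^ 3 * exp (h * \<bar>z\<bar>) \<le> (6 * exp u) * exp u" using u by (intro mult_mono) auto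
    also have "\<dots> = 6 * exp (2 * u)" by (simp add: exp_add[symmetric])
    also have "exp (2 * u) \<le> exp (2 / s * z) + exp ((- 2 / s) * z)"
      using s by (auto simp: u_def abs_if)
    finally have "u ^ 3 * exp (h * \<bar>z\<bar>) \<le> 6 * (exp (2 / s * z) + exp ((- 2 / s) * z))"
      by simp
    then have "s ^ 3 * (u ^ 3 * exp (h * \<bar>z\<bar>)) \<le> s ^ 3 * (6 * (exp (2 / s * z) + exp ((- 2 / s) * z)))"
      using s by (intro mult_left_mono) auto
    moreover have "\<bar>z\<bar> ^ 3 = s ^ 3 * u ^ 3" by (simp only: u power_mult_distrib)
    ultimately show ?thesis by (simp only: mult.assoc mult.left_commute[of 6])
  qed
  have "expectation (\<lambda>\<omega>. \<bar>Z \<omega>\<bar> ^ 3 * exp (h * \<bar>Z \<omega>\<bar>)) \<le>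
      expectation (\<lambda>\<omega>. 6 * s ^ 3 * (exp (2 / s * Z \<omega>) + exp ((- 2 / s) * Z \<omega>)))"
    using normal_exp_moment(1)[OF Z s] exp_moments_integrable_cube[OF em] pt
    by (intro integral_mono integrable_mult_right Bochner_Integration.integrable_add) blast+
  also have "\<dots> = 12 * exp 2 * s ^ 3"
    using normal_exp_moment[OF Z s, of "2 / s"] normal_exp_moment[OF Z s, of "- 2 / s"] s
    by (simp add: power_divide)
  finally show "expectation (\<lambda>\<omega>. \<bar>Z \<omega>\<bar> ^ 3 * exp (h * \<bar>Z \<omega>\<bar>)) \<le> 12 * exp 2 * s ^ 3" .
qed

end

section \<open>Independent copies on product spaces and transfer of laws\<close>

lemma indep_vars_PiM_coordinates:
  assumes P: "\<And>j. j \<in> J \<Longrightarrow> prob_space (P j)" and J: "J \<noteq> {}"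
    and sets: "\<And>j. j \<in> J \<Longrightarrow> sets (P j) = sets N"
  shows "prob_space.indep_vars (PiM J P) (\<lambda>_. N) (\<lambda>j \<omega>. \<omega> j) J"
proof -
  interpret prob_space "PiM J P" by (rule prob_space_PiM) (rule P)
  have rv: "(\<lambda>\<omega>. \<omega> j) \<in> measurable (PiM J P) N" if "j \<in> J" for j
    using measurable_component_singleton[OF that, of P] measurable_cong_sets[OF refl sets[OF that]] by blast
  have s: "sets (PiM J (\<lambda>_. N)) = sets (PiM J P)" by (rule sets_PiM_cong) (use sets in auto)
  \<comment> \<open>Restriction to \<open>J\<close> is the identity on the product space, so the
    joint law of the coordinates is the product measure itself, which is the product of the marginal
    laws.\<close>
  have "distr (PiM J P) (PiM J (\<lambda>_. N)) (\<lambda>\<omega>. \<lambda>j\<in>J. \<omega> j) = distr (PiM J P) (PiM J P) (\<lambda>\<omega>. \<omega>)"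
    by (rule distr_cong) (auto simp: s space_PiM PiE_def extensional_restrict)
  also have "\<dots> = PiM J P" by (rule distr_id2) simp
  also have "\<dots> = PiM J (\<lambda>j. distr (PiM J P) N (\<lambda>\<omega>. \<omega> j))"
  proof (rule PiM_cong[OF refl])
    fix j assume j: "j \<in> J"
    have "distr (PiM J P) N (\<lambda>\<omega>. \<omega> j) = distr (PiM J P) (P j) (\<lambda>\<omega>. \<omega> j)"
      by (rule distr_cong) (use sets j in auto)
    also have "\<dots> = P j" by (rule distr_PiM_component) (use P j in auto)
    finally show "P j = distr (PiM J P) N (\<lambda>\<omega>. \<omega> j)" ..
  qed
  finally show ?thesis using J rv by (subst indep_vars_iff_distr_eq_PiM') auto
qed

lemma (in prob_space) indep_vars_reindex_inj:
  assumes ind: "indep_vars (\<lambda>_. N) X (f ` I)" and f: "inj_on f I"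
  shows "indep_vars (\<lambda>_. N) (\<lambda>i. X (f i)) I"
proof -
  have "indep_vars (\<lambda>i. PiM {f i} (\<lambda>_. N)) (\<lambda>i \<omega>. restrict (\<lambda>j. X j \<omega>) {f i}) I"
    using f by (intro indep_vars_restrict[OF ind]) (auto simp: disjoint_family_on_def inj_on_def)
  then have "indep_vars (\<lambda>_. N) (\<lambda>i \<omega>. (\<lambda>g. g (f i)) (restrict (\<lambda>j. X j \<omega>) {f i})) I"
    by (rule indep_vars_compose2) auto
  then show ?thesis by simp
qed

text \<open>Under independence the joint law is the product of the marginals, and the sum is a
  measurable image of the joint vector. The two families may live on different spaces.\<close>

lemma distr_sum_indep_cong:
  fixes X :: "'i \<Rightarrow> 'a \<Rightarrow> real" and Y :: "'i \<Rightarrow> 'b \<Rightarrow> real"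
  assumes M: "prob_space M" "prob_space N" and I: "finite I" "I \<noteq> {}"
    and X: "prob_space.indep_vars M (\<lambda>_. borel) X I" and Y: "prob_space.indep_vars N (\<lambda>_. borel) Y I"
    and e: "\<And>i. i \<in> I \<Longrightarrow> distr M borel (X i) = distr N borel (Y i)"
  shows "distr M borel (\<lambda>\<omega>. \<Sum>i\<in>I. X i \<omega>) = distr N borel (\<lambda>\<omega>. \<Sum>i\<in>I. Y i \<omega>)"
proof -
  interpret M: prob_space M by fact
  interpret N: prob_space N by fact
  have mX: "X i \<in> borel_measurable M" and mY: "Y i \<in> borel_measurable N" if "i \<in> I" for i
    using X Y that by (auto simp: M.indep_vars_def N.indep_vars_def)
  have S[measurable]: "(\<lambda>g. \<Sum>i\<in>I. g i) \<in> borel_measurable (PiM I (\<lambda>_. borel :: real measure))"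
    by measurable
  have "distr M borel (\<lambda>\<omega>. \<Sum>i\<in>I. X i \<omega>) =
      distr (distr M (PiM I (\<lambda>_. borel)) (\<lambda>\<omega>. \<lambda>i\<in>I. X i \<omega>)) borel (\<lambda>g. \<Sum>i\<in>I. g i)"
    using mX by (subst distr_distr) (auto simp: comp_def intro!: measurable_restrict distr_cong)
  also have "distr M (PiM I (\<lambda>_. borel)) (\<lambda>\<omega>. \<lambda>i\<in>I. X i \<omega>) = PiM I (\<lambda>i. distr M borel (X i))"
    using M.indep_vars_iff_distr_eq_PiM'[THEN iffD1, OF I(2) mX X] .
  also have "\<dots> = PiM I (\<lambda>i. distr N borel (Y i))" by (rule PiM_cong) (use e in auto)
  also have "\<dots> = distr N (PiM I (\<lambda>_. borel)) (\<lambda>\<omega>. \<lambda>i\<in>I. Y i \<omega>)"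
    using N.indep_vars_iff_distr_eq_PiM'[THEN iffD1, OF I(2) mY Y] by simp
  also have "distr \<dots> borel (\<lambda>g. \<Sum>i\<in>I. g i) = distr N borel (\<lambda>\<omega>. \<Sum>i\<in>I. Y i \<omega>)"
    using mY by (subst distr_distr) (auto simp: comp_def intro!: measurable_restrict distr_cong)
  finally show ?thesis .
qed

lemma near_moments_distr:
  assumes d: "distr M borel V = distr N borel W" and V: "V \<in> borel_measurable M" and W: "W \<in> borel_measurable N"
    and nm: "near_moments M h s b q V"
  shows "near_moments N h s b q W"
proof -
  have i: "integrable M (\<lambda>\<omega>. g (V \<omega>)) = integrable N (\<lambda>\<omega>. g (W \<omega>))"
    and e: "(\<integral>\<omega>. g (V \<omega>) \<partial>M) = (\<integral>\<omega>. g (W \<omega>) \<partial>N)"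
    if "g \<in> borel_measurable borel" for g :: "real \<Rightarrow> real"
    using integrable_distr_eq[OF V that] integrable_distr_eq[OF W that] integral_distr[OF V that] integral_distr[OF W that] d
    by simp_all
  show ?thesis
    using nm W V i[of "\<lambda>x. exp (_ * x)"] e[of "\<lambda>x. x"] e[of "\<lambda>x. x\<^sup>2"] e[of "\<lambda>v. \<bar>v\<bar> ^ 3 * exp (h * \<bar>v\<bar>)"]
    unfolding near_moments_def exp_moments_def by simp
qed

text \<open>Since \<open>M\<close> may carry no independent normal variables, a product space is
  built that holds a copy of every \<open>Y i\<close> and a normal partner with the same standard
  deviation. The partners add up to a standard normal variable because the variances sum to
  1.\<close>

lemma (in prob_space) lindeberg_normal:
  fixes Y :: "'i \<Rightarrow> 'a \<Rightarrow> real"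
  assumes I: "finite I" "I \<noteq> {}" and ind: "indep_vars (\<lambda>_. borel) Y I"
    and nm: "\<And>i. i \<in> I \<Longrightarrow> near_moments M h (s i) (b i) (q i) (Y i)"
    and s: "\<And>i. i \<in> I \<Longrightarrow> 0 < s i" "(\<Sum>i\<in>I. (s i)\<^sup>2) = 1"
    and h: "0 \<le> h" "\<And>i. i \<in> I \<Longrightarrow> h * s i \<le> 1" and q: "\<And>i. i \<in> I \<Longrightarrow> 12 * exp 2 * s i ^ 3 \<le> q i"
    and F: "smooth_step a \<delta> F" and \<delta>: "0 < \<delta>"
  shows "\<bar>expectation (\<lambda>\<omega>. F 0 (\<Sum>i\<in>I. Y i \<omega>)) - (\<integral>z. F 0 z \<partial>std_normal_distribution)\<bar>
    \<le> 840 / \<delta> ^ 3 * exp (- h * a) * exp (h\<^sup>2 / 2 + (1 + h) ^ 3 * (\<Sum>i\<in>I. b i + q i)) *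
        (\<Sum>i\<in>I. 2 * (2 * b i + q i))"
proof -
  define P where "P = (\<lambda>(i, \<beta>). if \<beta> then distr M borel (Y i) else density lborel (normal_density 0 (s i)))"
  define J where "J = I \<times> (UNIV :: bool set)"
  have mY: "Y i \<in> borel_measurable M" if "i \<in> I" for i
    using ind that by (auto simp: indep_vars_def)
  have P: "prob_space (P j)" if "j \<in> J" for j
    using that mY s by (auto simp: J_def P_def prob_space_distr prob_space_normal_density)
  have sP: "sets (P j) = sets borel" for j by (auto simp: P_def split: prod.splits)
  define N where "N = PiM J P"
  interpret N: prob_space N unfolding N_def by (rule prob_space_PiM) (rule P)
  define V where "V j \<omega> = (\<omega> j :: real)" for j :: "'i \<times> bool" and \<omega>
  have J: "J \<noteq> {}" using I by (auto simp: J_def)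
  have indV: "N.indep_vars (\<lambda>_. borel) V J"
    unfolding N_def V_def[abs_def] by (rule indep_vars_PiM_coordinates) (use P J sP in auto)
  have mV: "V j \<in> borel_measurable N" if "j \<in> J" for j
    using indV that by (auto simp: N.indep_vars_def)
  have dV: "distr N borel (V j) = P j" if "j \<in> J" for j
  proof -
    have "distr N borel (V j) = distr N (P j) (V j)" by (rule distr_cong) (auto simp: sP)
    then show ?thesis unfolding N_def V_def[abs_def] using distr_PiM_component[OF P that] by simp
  qed
  have TJ: "(i, \<beta>) \<in> J" if "i \<in> I" for i \<beta> using that by (simp add: J_def)
  have Z: "distributed N lborel (V (i, False)) (normal_density 0 (s i))" if "i \<in> I" for i
    using dV[OF TJ[OF that, of False]] mV[OF TJ[OF that, of False]] unfolding distributed_def P_def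
    by (auto cong: distr_cong)
  have b0: "0 \<le> b i" if "i \<in> I" for i using nm[OF that] by (auto simp: near_moments_def)
  have nmV: "near_moments N h (s i) (b i) (q i) (V (i, \<beta>))" if i: "i \<in> I" for i \<beta>
  proof (cases \<beta>)
    case True
    have "distr M borel (Y i) = distr N borel (V (i, True))" using dV[OF TJ[OF i]] by (simp add: P_def)
    from near_moments_distr[OF this mY[OF i] mV[OF TJ[OF i]] nm[OF i]] True show ?thesis by simp
  next
    case False
    show ?thesis
      using near_moments_mono[OF N.near_moments_normal[OF Z[OF i] s(1)[OF i] h(2)[OF i]] b0[OF i] q[OF i]] False by simp
  qed
  have F0: "F 0 \<in> borel_measurable borel"
    by (rule smooth_step_borel_measurable[OF F]) simp
  have ind': "N.indep_vars (\<lambda>_. borel) (\<lambda>i. V (i, \<beta>)) I" for \<beta>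
    by (rule N.indep_vars_reindex_inj, rule N.indep_vars_subset[OF indV]) (auto simp: J_def inj_on_def)
  have dT: "distr M borel (\<lambda>\<omega>. \<Sum>i\<in>I. Y i \<omega>) = distr N borel (\<lambda>\<omega>. \<Sum>i\<in>I. V (i, True) \<omega>)"
    using dV[OF TJ] by (intro distr_sum_indep_cong prob_space_axioms N.prob_space_axioms I ind ind') (simp add: P_def)
  have eT: "expectation (\<lambda>\<omega>. F 0 (\<Sum>i\<in>I. Y i \<omega>)) = N.expectation (\<lambda>\<omega>. F 0 (\<Sum>i\<in>I. V (i, True) \<omega>))"
  proof -
    have "expectation (\<lambda>\<omega>. F 0 (\<Sum>i\<in>I. Y i \<omega>)) = (\<integral>z. F 0 z \<partial>distr M borel (\<lambda>\<omega>. \<Sum>i\<in>I. Y i \<omega>))"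
      by (rule integral_distr[symmetric]) (use mY F0 in auto)
    also have "\<dots> = N.expectation (\<lambda>\<omega>. F 0 (\<Sum>i\<in>I. V (i, True) \<omega>))"
      unfolding dT by (rule integral_distr) (use mV[OF TJ] F0 in auto)
    finally show ?thesis .
  qed
  have "distributed N lborel (\<lambda>\<omega>. \<Sum>i\<in>I. V (i, False) \<omega>) (normal_density (\<Sum>i\<in>I. 0) (sqrt (\<Sum>i\<in>I. (s i)\<^sup>2)))"
    by (rule N.sum_indep_normal[OF I ind' s(1) Z])
  then have D: "distributed N lborel (\<lambda>\<omega>. \<Sum>i\<in>I. V (i, False) \<omega>) std_normal_density" by (simp add: s)
  have "N.expectation (\<lambda>\<omega>. F 0 (\<Sum>i\<in>I. V (i, False) \<omega>)) = (\<integral>z. F 0 z \<partial>distr N lborel (\<lambda>\<omega>. \<Sum>i\<in>I. V (i, False) \<omega>))"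
    by (rule integral_distr[symmetric]) (use mV[OF TJ] F0 in auto)
  then have eF: "N.expectation (\<lambda>\<omega>. F 0 (\<Sum>i\<in>I. V (i, False) \<omega>)) = (\<integral>z. F 0 z \<partial>std_normal_distribution)"
    using distributed_distr_eq_density[OF D] by simp
  have "(\<Sum>i\<in>I. h\<^sup>2 * (s i)\<^sup>2 / 2 + (1 + h) ^ 3 * (b i + q i)) = h\<^sup>2 / 2 * (\<Sum>i\<in>I. (s i)\<^sup>2) + (1 + h) ^ 3 * (\<Sum>i\<in>I. b i + q i)"
    unfolding sum.distrib[of _ "\<lambda>i. (1 + h) ^ 3 * (b i + q i)"] sum_distrib_left by simp
  then have e: "(\<Sum>i\<in>I. h\<^sup>2 * (s i)\<^sup>2 / 2 + (1 + h) ^ 3 * (b i + q i)) = h\<^sup>2 / 2 + (1 + h) ^ 3 * (\<Sum>i\<in>I. b i + q i)"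
    using s by simp
  show ?thesis
    using N.lindeberg_replacement[OF I(1) indV[unfolded J_def] nmV h(1) F \<delta>] unfolding eT eF e .
qed

section \<open>Truncation\<close>

text \<open>Large values go to 0 instead of being clipped to the level \<open>y\<close>, so the
  error is either 0 or \<open>v\<close> itself, and for |v| > y \<ge> 1 it is dominated by the
  \<open>p\<close>-th power.\<close>

definition trunc :: "real \<Rightarrow> real \<Rightarrow> real" where
  "trunc y v = (if \<bar>v\<bar> \<le> y then v else 0)"

lemma trunc_borel_measurable[measurable]: "trunc y \<in> borel_measurable borel"
  unfolding trunc_def[abs_def] by measurable

lemma abs_trunc_le: "0 \<le> y \<Longrightarrow> \<bar>trunc y v\<bar> \<le> y" by (simp add: trunc_def)

lemma abs_le_abs_powr: "1 \<le> \<bar>v\<bar> \<Longrightarrow> 2 \<le> p \<Longrightarrow> \<bar>v\<bar> \<le> \<bar>v\<bar> powr p \<and> v\<^sup>2 \<le> \<bar>v\<bar> powr p" for v p :: real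
proof
  assume v: "1 \<le> \<bar>v\<bar>" "2 \<le> p"
  show "\<bar>v\<bar> \<le> \<bar>v\<bar> powr p" using powr_mono[of 1 p "\<bar>v\<bar>"] v by simp
  show "v\<^sup>2 \<le> \<bar>v\<bar> powr p" using powr_mono[of 2 p "\<bar>v\<bar>"] v by simp
qed

text \<open>Three zones: for |v| \<le> \<tau> one factor |v| is at most \<tau> and the weight is at
  most exp 1; for \<tau> < |v| \<le> y the bound at level \<open>y\<close> is multiplied by
  (|v|/\<tau>)^p \<ge> 1; beyond \<open>y\<close> the left side is 0.\<close>

lemma trunc_cube_exp_bound:
  assumes h: "0 \<le> h" and \<tau>: "0 < \<tau>" "h * \<tau> \<le> 1" and y: "0 \<le> y" and p: "0 \<le> p"
  shows "\<bar>trunc y v\<bar> ^ 3 * exp (h * \<bar>trunc y v\<bar>) \<le>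
    exp 1 * \<tau> * v\<^sup>2 + y ^ 3 * exp (h * y) * \<tau> powr (- p) * \<bar>v\<bar> powr p"
proof (cases "\<bar>v\<bar> \<le> y")
  case v: True
  show ?thesis
  proof (cases "\<bar>v\<bar> \<le> \<tau>")
    case True
    have "h * \<bar>v\<bar> \<le> 1" using True h \<tau> by (meson mult_left_mono order_trans)
    then have "\<bar>v\<bar> * \<bar>v\<bar>\<^sup>2 * exp (h * \<bar>v\<bar>) \<le> \<tau> * \<bar>v\<bar>\<^sup>2 * exp 1"
      using True by (intro mult_mono) auto
    moreover have "\<bar>v\<bar> * \<bar>v\<bar>\<^sup>2 = \<bar>v\<bar> ^ 3" by (simp only: power_Suc[symmetric] numeral_3_eq_3 numeral_2_eq_2)
    moreover have "\<tau> * \<bar>v\<bar>\<^sup>2 * exp 1 = exp 1 * \<tau> * v\<^sup>2" by simp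
    ultimately have "\<bar>v\<bar> ^ 3 * exp (h * \<bar>v\<bar>) \<le> exp 1 * \<tau> * v\<^sup>2" by metis
    moreover have "0 \<le> y ^ 3 * exp (h * y) * \<tau> powr (- p) * \<bar>v\<bar> powr p" using y by simp
    moreover have "trunc y v = v" using v by (simp add: trunc_def)
    ultimately show ?thesis by (metis add_increasing2)
  next
    case False
    have "\<bar>v\<bar> ^ 3 * exp (h * \<bar>v\<bar>) \<le> y ^ 3 * exp (h * y) * 1"
      using v h y by (auto intro!: mult_mono power_mono mult_left_mono)
    also have "1 \<le> (\<bar>v\<bar> / \<tau>) powr p" using False \<tau> p by (intro ge_one_powr_ge_zero) auto
    also have "(\<bar>v\<bar> / \<tau>) powr p = \<tau> powr (- p) * \<bar>v\<bar> powr p"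
      using \<tau> by (simp add: powr_divide powr_minus_divide)
    finally have "\<bar>v\<bar> ^ 3 * exp (h * \<bar>v\<bar>) \<le> y ^ 3 * exp (h * y) * (\<tau> powr (- p) * \<bar>v\<bar> powr p)"
      using y by (simp add: mult_left_mono)
    moreover have "0 \<le> exp 1 * \<tau> * v\<^sup>2" using \<tau> by simp
    ultimately show ?thesis using v by (simp add: trunc_def mult.assoc)
  qed
next
  case False
  then show ?thesis using \<tau> y by (simp add: trunc_def)
qed

context prob_space
begin

lemma exp_moments_bounded:
  assumes V: "V \<in> borel_measurable M" and b: "\<And>\<omega>. \<bar>V \<omega>\<bar> \<le> B"
  shows "exp_moments M V"
  unfolding exp_moments_def
proof (intro conjI allI V)
  fix c
  have "c * V \<omega> \<le> \<bar>c\<bar> * B" for \<omega>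
  proof -
    have "c * V \<omega> \<le> \<bar>c\<bar> * \<bar>V \<omega>\<bar>" by (metis abs_ge_self abs_mult)
    also have "\<dots> \<le> \<bar>c\<bar> * B" using b by (intro mult_left_mono) auto
    finally show ?thesis .
  qed
  then show "integrable M (\<lambda>\<omega>. exp (c * V \<omega>))"
    using V by (intro integrable_const_bound[where B="exp (\<bar>c\<bar> * B)"]) auto
qed

text \<open>As \<open>X\<close> is centered with second moment s^2, the biases are the means of what
  truncation removes. This lives where |X| > y \<ge> 1, so |X| and X^2 are at most |X|^p there. The
  weighted third moment comes from integrating \<open>trunc_cube_exp_bound\<close>.\<close>

lemma near_moments_trunc:
  assumes [measurable]: "X \<in> borel_measurable M"
    and i: "integrable M X" "integrable M (\<lambda>\<omega>. (X \<omega>)\<^sup>2)" "integrable M (\<lambda>\<omega>. \<bar>X \<omega>\<bar> powr p)"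
    and e: "expectation X = 0" "expectation (\<lambda>\<omega>. (X \<omega>)\<^sup>2) = s\<^sup>2"
    and p: "2 \<le> p" and y: "1 \<le> y" and h: "0 \<le> h" and \<tau>: "0 < \<tau>" "h * \<tau> \<le> 1"
  defines "\<beta> \<equiv> expectation (\<lambda>\<omega>. \<bar>X \<omega>\<bar> powr p)"
  shows "near_moments M h s \<beta> (exp 1 * \<tau> * s\<^sup>2 + y ^ 3 * exp (h * y) * \<tau> powr (- p) * \<beta>) (\<lambda>\<omega>. trunc y (X \<omega>))"
  unfolding near_moments_def
proof (intro conjI)
  show em: "exp_moments M (\<lambda>\<omega>. trunc y (X \<omega>))"
    using y by (intro exp_moments_bounded[where B=y] abs_trunc_le) auto
  note ip = exp_moments_integrable_power[OF em] exp_moments_integrable_cube[OF em]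
  have b: "\<bar>trunc y v - v\<bar> \<le> \<bar>v\<bar> powr p" "\<bar>(trunc y v)\<^sup>2 - v\<^sup>2\<bar> \<le> \<bar>v\<bar> powr p" for v
    using abs_le_abs_powr[of v p] p y by (auto simp: trunc_def)
  have "expectation (\<lambda>\<omega>. trunc y (X \<omega>)) = expectation (\<lambda>\<omega>. trunc y (X \<omega>) - X \<omega>)"
    using ip i e by simp
  also have "\<bar>\<dots>\<bar> \<le> expectation (\<lambda>\<omega>. \<bar>trunc y (X \<omega>) - X \<omega>\<bar>)" by (rule integral_abs_bound)
  also have "\<dots> \<le> \<beta>" unfolding \<beta>_def using ip i b by (intro integral_mono) auto
  finally show "\<bar>expectation (\<lambda>\<omega>. trunc y (X \<omega>))\<bar> \<le> \<beta>" .
  have "expectation (\<lambda>\<omega>. (trunc y (X \<omega>))\<^sup>2) - s\<^sup>2 = expectation (\<lambda>\<omega>. (trunc y (X \<omega>))\<^sup>2 - (X \<omega>)\<^sup>2)"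
    using ip i e by simp
  also have "\<bar>\<dots>\<bar> \<le> expectation (\<lambda>\<omega>. \<bar>(trunc y (X \<omega>))\<^sup>2 - (X \<omega>)\<^sup>2\<bar>)" by (rule integral_abs_bound)
  also have "\<dots> \<le> \<beta>" unfolding \<beta>_def using ip i b by (intro integral_mono) auto
  finally show "\<bar>expectation (\<lambda>\<omega>. (trunc y (X \<omega>))\<^sup>2) - s\<^sup>2\<bar> \<le> \<beta>" .
  have "expectation (\<lambda>\<omega>. \<bar>trunc y (X \<omega>)\<bar> ^ 3 * exp (h * \<bar>trunc y (X \<omega>)\<bar>)) \<le>
      expectation (\<lambda>\<omega>. exp 1 * \<tau> * (X \<omega>)\<^sup>2 + y ^ 3 * exp (h * y) * \<tau> powr (- p) * \<bar>X \<omega>\<bar> powr p)"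
    using ip i p y by (intro integral_mono trunc_cube_exp_bound h \<tau>) auto
  also have "\<dots> = exp 1 * \<tau> * s\<^sup>2 + y ^ 3 * exp (h * y) * \<tau> powr (- p) * \<beta>"
    using i e by (simp add: \<beta>_def)
  finally show "expectation (\<lambda>\<omega>. \<bar>trunc y (X \<omega>)\<bar> ^ 3 * exp (h * \<bar>trunc y (X \<omega>)\<bar>)) \<le>
      exp 1 * \<tau> * s\<^sup>2 + y ^ 3 * exp (h * y) * \<tau> powr (- p) * \<beta>" .
qed

end

text \<open>This bounds the total of biases and weighted third moments over all summands. The 120
  covers exp 1 + 12 exp 2, from truncated and normal variables together; the factor 2 leaves room
  for the biases.\<close>

definition clt_error :: "real \<Rightarrow> real \<Rightarrow> real \<Rightarrow> real \<Rightarrow> real \<Rightarrow> real" where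
  "clt_error p B h y \<tau> = 120 * \<tau> + 2 * B * y ^ 3 * exp (h * y) * \<tau> powr p"

text \<open>The exponent \<open>2 * p\<close> fixes the scale: \<tau> plays the role of the Lyapunov
  ratio to the power 1/(2p). Truncation at the inner threshold \<tau> costs \<tau>^(-p), so a small
  factor \<tau>^p survives.\<close>

locale normalized_sum = prob_space M for M :: "'a measure" +
  fixes I :: "'i set" and X :: "'i \<Rightarrow> 'a \<Rightarrow> real" and s :: "'i \<Rightarrow> real" and p B \<tau> :: real
  assumes I: "finite I" "I \<noteq> {}" and ind: "indep_vars (\<lambda>_. borel) X I"
    and X_int: "\<And>i. i \<in> I \<Longrightarrow> integrable M (X i)" "\<And>i. i \<in> I \<Longrightarrow> integrable M (\<lambda>\<omega>. (X i \<omega>)\<^sup>2)"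
      "\<And>i. i \<in> I \<Longrightarrow> integrable M (\<lambda>\<omega>. \<bar>X i \<omega>\<bar> powr p)"
    and X_moments: "\<And>i. i \<in> I \<Longrightarrow> expectation (X i) = 0" "\<And>i. i \<in> I \<Longrightarrow> expectation (\<lambda>\<omega>. (X i \<omega>)\<^sup>2) = (s i)\<^sup>2"
    and s: "\<And>i. i \<in> I \<Longrightarrow> 0 < s i" "\<And>i. i \<in> I \<Longrightarrow> s i \<le> \<tau>" "(\<Sum>i\<in>I. (s i)\<^sup>2) = 1"
    and X_powr: "(\<Sum>i\<in>I. expectation (\<lambda>\<omega>. \<bar>X i \<omega>\<bar> powr p)) \<le> B * \<tau> powr (2 * p)"
    and p: "2 \<le> p" and \<tau>: "0 < \<tau>" "\<tau> \<le> 1" and B: "0 \<le> B"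
begin

lemma X_measurable: "i \<in> I \<Longrightarrow> X i \<in> borel_measurable M"
  using X_int(1) by blast

lemma trunc_sum_normal:
  assumes h: "0 \<le> h" "h * \<tau> \<le> 1" and y: "1 \<le> y"
    and F: "smooth_step a \<delta> F" and \<delta>: "0 < \<delta>"
  defines "Q \<equiv> clt_error p B h y \<tau>"
  shows "\<bar>expectation (\<lambda>\<omega>. F 0 (\<Sum>i\<in>I. trunc y (X i \<omega>))) - (\<integral>z. F 0 z \<partial>std_normal_distribution)\<bar>
    \<le> 840 / \<delta> ^ 3 * exp (- h * a) * exp (h\<^sup>2 / 2 + (1 + h) ^ 3 * Q) * (4 * Q)"
proof -
  define \<beta> where "\<beta> i = expectation (\<lambda>\<omega>. \<bar>X i \<omega>\<bar> powr p)" for i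
  \<comment> \<open>The budget adds the bound for the truncated variable and the bound for its
    normal partner, the latter with s^3 replaced by \<tau> s^2 so that it can be summed.\<close>
  define q where "q i = exp 1 * \<tau> * (s i)\<^sup>2 + y ^ 3 * exp (h * y) * \<tau> powr (- p) * \<beta> i + 12 * exp 2 * \<tau> * (s i)\<^sup>2" for i
  have \<beta>0: "0 \<le> \<beta> i" for i unfolding \<beta>_def by (intro integral_nonneg_AE) auto
  have q0: "0 \<le> q i" for i unfolding q_def using \<tau> y \<beta>0 by simp
  have nm: "near_moments M h (s i) (\<beta> i) (q i) (\<lambda>\<omega>. trunc y (X i \<omega>))" if "i \<in> I" for i
    by (rule near_moments_mono[OF near_moments_trunc[of "X i" p "s i" y h \<tau>]])
      (use that X_measurable X_int X_moments p y h \<tau> in \<open>auto simp: q_def \<beta>_def\<close>)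
  have indY: "indep_vars (\<lambda>_. borel) (\<lambda>i \<omega>. trunc y (X i \<omega>)) I"
    by (rule indep_vars_compose2[OF ind]) auto
  have hs: "h * s i \<le> 1" if "i \<in> I" for i
    using s(2)[OF that] h by (meson mult_left_mono order_trans)
  have qs: "12 * exp 2 * s i ^ 3 \<le> q i" if i: "i \<in> I" for i
  proof -
    have "s i ^ 3 \<le> \<tau> * (s i)\<^sup>2" using s(2)[OF i] by (simp add: eval_nat_numeral mult_right_mono)
    then have "12 * exp 2 * s i ^ 3 \<le> 12 * exp 2 * (\<tau> * (s i)\<^sup>2)" by (intro mult_left_mono) auto
    moreover have "0 \<le> exp 1 * \<tau> * (s i)\<^sup>2 + y ^ 3 * exp (h * y) * \<tau> powr (- p) * \<beta> i"
      using \<tau> y \<beta>0 by simp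
    ultimately show ?thesis unfolding q_def mult.assoc by linarith
  qed
  have E: "y ^ 3 * exp (h * y) \<ge> 1" using y h by (simp add: mult_ge1_I one_le_power)
  have sb: "sum \<beta> I \<le> B * \<tau> powr (2 * p)" using X_powr by (simp add: \<beta>_def)
  have "sum q I = exp 1 * \<tau> * (\<Sum>i\<in>I. (s i)\<^sup>2) + y ^ 3 * exp (h * y) * \<tau> powr (- p) * sum \<beta> I + 12 * exp 2 * \<tau> * (\<Sum>i\<in>I. (s i)\<^sup>2)"
    by (simp add: q_def sum.distrib sum_distrib_left)
  also have "\<dots> \<le> exp 1 * \<tau> + y ^ 3 * exp (h * y) * \<tau> powr (- p) * (B * \<tau> powr (2 * p)) + 12 * exp 2 * \<tau>"
    unfolding s(3) using sb y by (intro add_mono mult_left_mono) auto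
  also have "y ^ 3 * exp (h * y) * \<tau> powr (- p) * (B * \<tau> powr (2 * p)) = B * y ^ 3 * exp (h * y) * (\<tau> powr (- p) * \<tau> powr (2 * p))"
    by (simp add: mult_ac)
  also have "\<tau> powr (- p) * \<tau> powr (2 * p) = \<tau> powr p" by (simp add: powr_add[symmetric])
  finally have sq: "sum q I \<le> (exp 1 + 12 * exp 2) * \<tau> + B * y ^ 3 * exp (h * y) * \<tau> powr p"
    by (simp add: algebra_simps)
  have "exp 2 = exp (1::real) ^ 2" by (simp add: exp_double[symmetric])
  also have "\<dots> \<le> 3 ^ 2" using exp_le by (intro power_mono) auto
  finally have "exp 1 + 12 * exp 2 \<le> (120::real)" using exp_le by simp
  then have "(exp 1 + 12 * exp 2) * \<tau> \<le> 120 * \<tau>" using \<tau> by (intro mult_right_mono) auto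
  \<comment> \<open>The sum of the biases is absorbed into a second copy of the third-moment term,
    because \<tau> \<le> 1 and the cut-off factor is at least 1.\<close>
  moreover have "B * \<tau> powr (2 * p) \<le> B * y ^ 3 * exp (h * y) * \<tau> powr p"
  proof -
    have "\<tau> powr (2 * p) \<le> \<tau> powr p" using \<tau> p by (intro powr_mono') auto
    also have "\<dots> \<le> y ^ 3 * exp (h * y) * \<tau> powr p" using mult_right_mono[OF E, of "\<tau> powr p"] by simp
    finally show ?thesis using mult_left_mono[OF _ B] by (simp add: mult.assoc)
  qed
  ultimately have sum: "(\<Sum>i\<in>I. \<beta> i + q i) \<le> Q"
    using sb sq unfolding sum.distrib Q_def clt_error_def by linarith
  have "(\<Sum>i\<in>I. 2 * (2 * \<beta> i + q i)) \<le> (\<Sum>i\<in>I. 4 * (\<beta> i + q i))"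
    using q0 by (intro sum_mono) auto
  also have "\<dots> \<le> 4 * Q" using sum by (simp only: sum_distrib_left[symmetric])
  finally have sum2: "(\<Sum>i\<in>I. 2 * (2 * \<beta> i + q i)) \<le> 4 * Q" .
  note lindeberg_normal[OF I indY nm s(1) s(3) h(1) hs qs F \<delta>]
  also have "840 / \<delta> ^ 3 * exp (- h * a) * exp (h\<^sup>2 / 2 + (1 + h) ^ 3 * (\<Sum>i\<in>I. \<beta> i + q i)) * (\<Sum>i\<in>I. 2 * (2 * \<beta> i + q i))
     \<le> 840 / \<delta> ^ 3 * exp (- h * a) * exp (h\<^sup>2 / 2 + (1 + h) ^ 3 * Q) * (4 * Q)"
    using sum sum2 \<delta> h \<beta>0 q0 by (intro mult_mono) (auto intro!: mult_left_mono sum_nonneg)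
  finally show ?thesis .
qed

end

section \<open>Tail probabilities of normalized sums\<close>

definition normal_tail :: "real \<Rightarrow> real" where
  "normal_tail x = 1 - std_normal_cdf x"

interpretation std_normal: prob_space std_normal_distribution
  by (rule prob_space_normal_density) simp

lemma normal_tail_eq_measure: "normal_tail x = measure std_normal_distribution {x<..}"
proof -
  have "measure std_normal_distribution (space std_normal_distribution - {..x}) = 1 - measure std_normal_distribution {..x}"
    by (rule std_normal.prob_compl) simp
  moreover have "space std_normal_distribution - {..x} = {x<..}" by auto
  ultimately show ?thesis by (simp add: normal_tail_def std_normal_cdf_def cdf_def)
qed

lemma normal_tail_diff: "a \<le> b \<Longrightarrow> normal_tail a - normal_tail b = measure std_normal_distribution {a<..b}"
proof -
  assume ab: "a \<le> b"
  have "measure std_normal_distribution ({a<..b} \<union> {b<..}) = measure std_normal_distribution {a<..b} + measure std_normal_distribution {b<..}"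
    by (rule std_normal.finite_measure_Union) auto
  moreover have "{a<..b} \<union> {b<..} = {a<..}" using ab by auto
  ultimately show ?thesis by (simp add: normal_tail_eq_measure)
qed

lemma measure_std_normal_interval:
  assumes "a \<le> b"
  shows "measure std_normal_distribution {a<..b} = (\<integral>z. std_normal_density z * indicator {a<..b} z \<partial>lborel)"
    and "integrable lborel (\<lambda>z. std_normal_density z * indicator {a<..b} z)"
proof -
  show i: "integrable lborel (\<lambda>z. std_normal_density z * indicator {a<..b} z)"
    by (rule integrable_real_mult_indicator) auto
  have "emeasure std_normal_distribution {a<..b} = (\<integral>\<^sup>+z. ennreal (std_normal_density z * indicator {a<..b} z) \<partial>lborel)"
    by (subst emeasure_density) (auto intro!: nn_integral_cong simp: indicator_def)
  also have "\<dots> = ennreal (\<integral>z. std_normal_density z * indicator {a<..b} z \<partial>lborel)"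
    using i by (intro nn_integral_eq_integral) auto
  finally show "measure std_normal_distribution {a<..b} = (\<integral>z. std_normal_density z * indicator {a<..b} z \<partial>lborel)"
    by (simp add: measure_def integral_nonneg_AE)
qed

lemma integral_const_indicator:
  assumes "a \<le> b"
  shows "(\<integral>z. K * indicator {a<..b} z \<partial>lborel) = K * (b - a)"
    and "integrable lborel (\<lambda>z. K * indicator {a<..b::real} z :: real)"
  using assms by (auto intro!: integrable_real_indicator simp: emeasure_lborel_Ioc)

lemma measure_std_normal_interval_bounds:
  assumes ab: "a \<le> b"
  shows "(\<And>z. a < z \<Longrightarrow> z \<le> b \<Longrightarrow> std_normal_density z \<le> K) \<Longrightarrow> measure std_normal_distribution {a<..b} \<le> K * (b - a)"
    and "(\<And>z. a < z \<Longrightarrow> z \<le> b \<Longrightarrow> K \<le> std_normal_density z) \<Longrightarrow> K * (b - a) \<le> measure std_normal_distribution {a<..b}"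
  unfolding measure_std_normal_interval(1)[OF ab] integral_const_indicator(1)[OF ab, symmetric]
  by (intro integral_mono measure_std_normal_interval(2) integral_const_indicator(2) ab;
      auto simp: indicator_def)+

text \<open>On the interval z^2 \<ge> x^2 + 2x(z-x) \<ge> x^2 - 2|x|\<delta>, and the density is at
  most exp(-z^2/2). Multiply by the length.\<close>

lemma normal_tail_diff_bound:
  assumes "a \<le> b" "\<bar>a - x\<bar> \<le> \<delta>" "\<bar>b - x\<bar> \<le> \<delta>"
  shows "normal_tail a - normal_tail b \<le> (b - a) * exp (- x\<^sup>2 / 2 + \<bar>x\<bar> * \<delta>)"
proof -
  have "std_normal_density z \<le> exp (- x\<^sup>2 / 2 + \<bar>x\<bar> * \<delta>)" if z: "a < z" "z \<le> b" for z
  proof -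
    have "\<bar>z - x\<bar> \<le> \<delta>" using z assms by linarith
    then have "\<bar>x\<bar> * \<bar>z - x\<bar> \<le> \<bar>x\<bar> * \<delta>" by (intro mult_left_mono) auto
    then have "- (x * (z - x)) \<le> \<bar>x\<bar> * \<delta>"
      unfolding abs_mult[symmetric] by (rule order_trans[OF abs_ge_minus_self])
    moreover have "0 \<le> (z - x)\<^sup>2" by simp
    ultimately have "- z\<^sup>2 / 2 \<le> - x\<^sup>2 / 2 + \<bar>x\<bar> * \<delta>"
      by (simp add: power2_eq_square algebra_simps)
    then have e: "exp (- z\<^sup>2 / 2) \<le> exp (- x\<^sup>2 / 2 + \<bar>x\<bar> * \<delta>)" by (simp only: exp_le_cancel_iff)
    have "std_normal_density z = 1 / sqrt (2 * pi) * exp (- z\<^sup>2 / 2)" by (rule std_normal_density_def)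
    moreover have "1 \<le> sqrt (2 * pi)" using pi_gt3 by simp
    then have "1 / sqrt (2 * pi) * exp (- z\<^sup>2 / 2) \<le> 1 * exp (- z\<^sup>2 / 2)"
      by (intro mult_right_mono) auto
    ultimately show ?thesis using e by linarith
  qed
  from measure_std_normal_interval_bounds(1)[OF assms(1) this] show ?thesis
    using normal_tail_diff[OF assms(1)] by (simp add: mult.commute)
qed

lemma normal_tail_nonneg: "0 \<le> normal_tail x" by (simp add: normal_tail_eq_measure)

lemma normal_tail_antimono: "a \<le> b \<Longrightarrow> normal_tail b \<le> normal_tail a"
  unfolding normal_tail_eq_measure by (rule std_normal.finite_measure_mono) auto

text \<open>The interval from x to x + 1/x suffices: there z^2 \<le> x^2 + 2 + 1/x^2 \<le> x^2 + 3,
  so the density loses only a constant, and the length supplies the factor 1/x.\<close>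

lemma normal_tail_lower_bound:
  assumes x: "1 \<le> x"
  shows "exp (- 3 / 2) / sqrt (2 * pi) * (exp (- x\<^sup>2 / 2) / x) \<le> normal_tail x"
proof -
  have "exp (- 3 / 2) / sqrt (2 * pi) * exp (- x\<^sup>2 / 2) \<le> std_normal_density z" if z: "x < z" "z \<le> x + 1 / x" for z
  proof -
    have "z\<^sup>2 \<le> (x + 1 / x)\<^sup>2" using z x by (intro power_mono) auto
    also have "\<dots> = x\<^sup>2 + 2 + (1 / x)\<^sup>2" using x by (simp add: power2_sum)
    also have "(1 / x)\<^sup>2 \<le> 1" using x by (intro power_le_one) auto
    finally have "exp (- 3 / 2 + (- x\<^sup>2 / 2)) \<le> exp (- z\<^sup>2 / 2)" by simp
    then show ?thesis unfolding exp_add by (simp add: std_normal_density_def divide_right_mono)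
  qed
  from measure_std_normal_interval_bounds(2)[of x "x + 1 / x", OF _ this] x
  have "exp (- 3 / 2) / sqrt (2 * pi) * exp (- x\<^sup>2 / 2) * (x + 1 / x - x) \<le> measure std_normal_distribution {x<..x + 1 / x}"
    by auto
  also have "\<dots> \<le> normal_tail x"
    using normal_tail_diff[of x "x + 1 / x"] normal_tail_nonneg[of "x + 1 / x"] x by simp
  finally show ?thesis by simp
qed

lemma normal_tail_pos: "0 < normal_tail x"
proof -
  have "0 < exp (- 3 / 2) / sqrt (2 * pi) * (exp (- (max 1 x)\<^sup>2 / 2) / max 1 x)" by simp
  also have "\<dots> \<le> normal_tail (max 1 x)" by (rule normal_tail_lower_bound) simp
  also have "\<dots> \<le> normal_tail x" by (rule normal_tail_antimono) simp
  finally show ?thesis .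
qed

lemma smooth_step_normal_bounds:
  assumes F: "smooth_step a \<delta> F"
  shows "(\<integral>z. F 0 z \<partial>std_normal_distribution) \<le> normal_tail a"
    and "normal_tail (a + \<delta>) \<le> (\<integral>z. F 0 z \<partial>std_normal_distribution)"
proof -
  have [measurable]: "F 0 \<in> borel_measurable borel" by (rule smooth_step_borel_measurable[OF F]) simp
  have Fb: "F 0 s \<le> indicator {a<..} s" "indicator {a + \<delta><..} s \<le> F 0 s" "\<bar>F 0 s\<bar> \<le> 1" for s
    using F unfolding smooth_step_def by (auto simp: indicator_def not_less)
  have iF: "integrable std_normal_distribution (F 0)"
    by (rule std_normal.integrable_const_bound[where B=1]) (use Fb(3) in auto)
  have ii: "integrable std_normal_distribution (indicator {c<..} :: real \<Rightarrow> real)"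
    and ei: "(\<integral>z. indicator {c<..} z \<partial>std_normal_distribution) = normal_tail c" for c
    by (auto simp: normal_tail_eq_measure intro!: integrable_real_indicator simp: std_normal.emeasure_eq_measure)
  show "(\<integral>z. F 0 z \<partial>std_normal_distribution) \<le> normal_tail a"
    unfolding ei[symmetric] by (intro integral_mono iF ii Fb)
  show "normal_tail (a + \<delta>) \<le> (\<integral>z. F 0 z \<partial>std_normal_distribution)"
    unfolding ei[symmetric] by (intro integral_mono iF ii Fb)
qed

section \<open>Truncation error and two-sided tail comparison\<close>

context normalized_sum
begin

text \<open>The two events can differ only if some summand reaches the level \<open>y\<close> in
  absolute value. The union bound and the Markov inequality for \<open>p\<close>-th powers do the
  rest.\<close>

lemma trunc_sum_tail:
  assumes y: "1 \<le> y"
  shows "\<bar>prob {\<omega> \<in> space M. x \<le> (\<Sum>i\<in>I. X i \<omega>)} - prob {\<omega> \<in> space M. x \<le> (\<Sum>i\<in>I. trunc y (X i \<omega>))}\<bar>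
    \<le> B * \<tau> powr (2 * p) * y powr (- p)"
proof -
  note [measurable] = X_measurable
  define S where "S = {\<omega> \<in> space M. x \<le> (\<Sum>i\<in>I. X i \<omega>)}"
  define T where "T = {\<omega> \<in> space M. x \<le> (\<Sum>i\<in>I. trunc y (X i \<omega>))}"
  define A where "A i = {\<omega> \<in> space M. y powr p \<le> \<bar>X i \<omega>\<bar> powr p}" for i
  have mX: "(\<lambda>\<omega>. \<Sum>i\<in>I. X i \<omega>) \<in> borel_measurable M" "(\<lambda>\<omega>. \<Sum>i\<in>I. trunc y (X i \<omega>)) \<in> borel_measurable M"
    by (auto intro!: borel_measurable_sum)
  have [measurable]: "S \<in> events" "T \<in> events" unfolding S_def T_def using mX by measurable
  have A: "A i \<in> events" if "i \<in> I" for i unfolding A_def using X_measurable[OF that] by measurable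
  have U: "(\<Union>i\<in>I. A i) \<in> events" using A I by auto
  have "S \<subseteq> T \<union> (\<Union>i\<in>I. A i)" "T \<subseteq> S \<union> (\<Union>i\<in>I. A i)"
  proof -
    have "(\<Sum>i\<in>I. trunc y (X i \<omega>)) = (\<Sum>i\<in>I. X i \<omega>)" if "\<omega> \<in> space M" "\<omega> \<notin> (\<Union>i\<in>I. A i)" for \<omega>
    proof (rule sum.cong[OF refl])
      fix i assume "i \<in> I"
      then have "\<not> y powr p \<le> \<bar>X i \<omega>\<bar> powr p" using that by (auto simp: A_def)
      then have "\<bar>X i \<omega>\<bar> \<le> y" using powr_mono2[of p y "\<bar>X i \<omega>\<bar>"] p y by linarith
      then show "trunc y (X i \<omega>) = X i \<omega>" by (simp add: trunc_def)
    qed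
    then show "S \<subseteq> T \<union> (\<Union>i\<in>I. A i)" "T \<subseteq> S \<union> (\<Union>i\<in>I. A i)" unfolding S_def T_def by auto
  qed
  then have 1: "prob S \<le> prob T + prob (\<Union>i\<in>I. A i)" "prob T \<le> prob S + prob (\<Union>i\<in>I. A i)"
    using U by (auto intro!: order_trans[OF finite_measure_mono measure_Un_le])
  have "prob (\<Union>i\<in>I. A i) \<le> (\<Sum>i\<in>I. prob (A i))"
    by (rule finite_measure_subadditive_finite) (use A I in auto)
  also have "\<dots> \<le> (\<Sum>i\<in>I. expectation (\<lambda>\<omega>. \<bar>X i \<omega>\<bar> powr p) / y powr p)"
    unfolding A_def using X_int(3) y by (intro sum_mono integral_Markov_inequality_measure[where A="{}"]) auto
  also have "\<dots> = (\<Sum>i\<in>I. expectation (\<lambda>\<omega>. \<bar>X i \<omega>\<bar> powr p)) * y powr (- p)"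
    by (simp add: sum_divide_distrib[symmetric] powr_minus_divide)
  also have "\<dots> \<le> B * \<tau> powr (2 * p) * y powr (- p)"
    using X_powr by (intro mult_right_mono) auto
  finally show ?thesis using 1 unfolding S_def T_def by linarith
qed

text \<open>The three error terms come from smoothing the indicator, from replacing the truncated
  summands by normal ones, and from undoing the truncation.\<close>

lemma tail_approximation:
  assumes h: "0 \<le> h" "h * \<tau> \<le> 1" and y: "1 \<le> y" and \<delta>: "0 < \<delta>" "\<delta> \<le> 1"
  defines "Q \<equiv> clt_error p B h y \<tau>"
  shows "\<bar>prob {\<omega> \<in> space M. x \<le> (\<Sum>i\<in>I. X i \<omega>)} - normal_tail x\<bar> \<le>
    \<delta> * exp (- x\<^sup>2 / 2 + \<bar>x\<bar> * \<delta>) +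
    840 / \<delta> ^ 3 * exp (- h * (x - \<delta>)) * exp (h\<^sup>2 / 2 + (1 + h) ^ 3 * Q) * (4 * Q) +
    B * \<tau> powr (2 * p) * y powr (- p)"
proof -
  define Y where "Y \<omega> = (\<Sum>i\<in>I. trunc y (X i \<omega>))" for \<omega>
  define E where "E = 840 / \<delta> ^ 3 * exp (- h * (x - \<delta>)) * exp (h\<^sup>2 / 2 + (1 + h) ^ 3 * Q) * (4 * Q)"
  have Q0: "0 \<le> Q" unfolding Q_def clt_error_def using \<tau> B y by simp
  note [measurable] = X_measurable
  have [measurable]: "Y \<in> borel_measurable M" unfolding Y_def[abs_def] by (auto intro!: borel_measurable_sum)
  define pT where "pT = prob {\<omega> \<in> space M. x \<le> Y \<omega>}"
  have pT: "pT = expectation (\<lambda>\<omega>. indicator {x..} (Y \<omega>))"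
  proof -
    have "expectation (\<lambda>\<omega>. indicator {x..} (Y \<omega>)) = expectation (indicator {\<omega> \<in> space M. x \<le> Y \<omega>})"
      by (rule Bochner_Integration.integral_cong) (auto simp: indicator_def)
    also have "\<dots> = pT" by (simp add: pT_def Int_absorb2 Collect_restrict)
    finally show ?thesis ..
  qed
  have iI: "integrable M (\<lambda>\<omega>. indicator {x..} (Y \<omega>) :: real)"
    by (rule integrable_const_bound[where B=1]) (auto simp: indicator_def)
  have iF: "integrable M (\<lambda>\<omega>. F 0 (Y \<omega>))" if F: "smooth_step a \<delta> F" for F a
  proof -
    have [measurable]: "F 0 \<in> borel_measurable borel" by (rule smooth_step_borel_measurable[OF F]) simp
    show ?thesis by (rule integrable_const_bound[where B=1]) (use F in \<open>auto simp: smooth_step_def\<close>)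
  qed
  \<comment> \<open>This step has already reached 1 at \<open>x\<close>, so it dominates the
    indicator and yields the upper bound.\<close>
  obtain F where F: "smooth_step (x - \<delta>) \<delta> F" using smooth_step_exists[OF \<delta>] by blast
  have "pT \<le> expectation (\<lambda>\<omega>. F 0 (Y \<omega>))"
    unfolding pT using F by (intro integral_mono iI iF[OF F]) (auto simp: indicator_def smooth_step_def)
  moreover have "\<bar>expectation (\<lambda>\<omega>. F 0 (Y \<omega>)) - (\<integral>z. F 0 z \<partial>std_normal_distribution)\<bar> \<le> E"
    unfolding Y_def E_def Q_def by (rule trunc_sum_normal[OF h y F \<delta>(1)])
  moreover have "(\<integral>z. F 0 z \<partial>std_normal_distribution) \<le> normal_tail (x - \<delta>)"
    by (rule smooth_step_normal_bounds(1)[OF F])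
  moreover have "normal_tail (x - \<delta>) - normal_tail x \<le> \<delta> * exp (- x\<^sup>2 / 2 + \<bar>x\<bar> * \<delta>)"
    using normal_tail_diff_bound[of "x - \<delta>" x x \<delta>] \<delta> by simp
  ultimately have up: "pT \<le> normal_tail x + \<delta> * exp (- x\<^sup>2 / 2 + \<bar>x\<bar> * \<delta>) + E" by linarith
  \<comment> \<open>This step starts rising at \<open>x\<close>, so it lies below the indicator and
    yields the lower bound. Its replacement error is at most the previous one since h \<ge>
    0.\<close>
  obtain G where G: "smooth_step x \<delta> G" using smooth_step_exists[OF \<delta>] by blast
  have "expectation (\<lambda>\<omega>. G 0 (Y \<omega>)) \<le> pT"
    unfolding pT using G by (intro integral_mono iI iF[OF G]) (auto simp: indicator_def smooth_step_def)
  moreover have "\<bar>expectation (\<lambda>\<omega>. G 0 (Y \<omega>)) - (\<integral>z. G 0 z \<partial>std_normal_distribution)\<bar> \<le>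
      840 / \<delta> ^ 3 * exp (- h * x) * exp (h\<^sup>2 / 2 + (1 + h) ^ 3 * Q) * (4 * Q)"
    unfolding Y_def Q_def by (rule trunc_sum_normal[OF h y G \<delta>(1)])
  moreover have "840 / \<delta> ^ 3 * exp (- h * x) * exp (h\<^sup>2 / 2 + (1 + h) ^ 3 * Q) * (4 * Q) \<le> E"
    unfolding E_def using \<delta> h Q0 by (intro mult_right_mono mult_left_mono) (auto simp: algebra_simps)
  moreover have "normal_tail (x + \<delta>) \<le> (\<integral>z. G 0 z \<partial>std_normal_distribution)"
    by (rule smooth_step_normal_bounds(2)[OF G])
  moreover have "normal_tail x - normal_tail (x + \<delta>) \<le> \<delta> * exp (- x\<^sup>2 / 2 + \<bar>x\<bar> * \<delta>)"
    using normal_tail_diff_bound[of x "x + \<delta>" x \<delta>] \<delta> by simp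
  ultimately have lo: "normal_tail x - \<delta> * exp (- x\<^sup>2 / 2 + \<bar>x\<bar> * \<delta>) - E \<le> pT" by linarith
  show ?thesis using up lo trunc_sum_tail[OF y, of x] unfolding pT_def Y_def E_def by linarith
qed

end

section \<open>Asymptotics of the error bounds\<close>

text \<open>The error of \<open>tail_approximation\<close> relative to \<open>exp (- x\<^sup>2 / 2) / x\<close>, for the choice \<open>h = x\<close>, \<open>y = x / 8\<close>,
  \<open>\<delta> = 1 / x\<^sup>2\<close> and \<open>\<tau> powr (2 * p) = exp (- x\<^sup>2 / 2)\<close>.\<close>
definition tail_error :: "real \<Rightarrow> real \<Rightarrow> real \<Rightarrow> real" where
  "tail_error p B x = (let Q = 120 * exp (- x\<^sup>2 / (4 * p)) + 2 * B * (x / 8) ^ 3 * exp (- x\<^sup>2 / 8) in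
     x * (exp (1 / x) / x\<^sup>2 + 840 * x ^ 6 * exp (1 / x) * exp ((1 + x) ^ 3 * Q) * (4 * Q) + B * (x / 8) powr (- p)))"

text \<open>\<open>Q\<close> decays like a Gaussian and therefore beats x^7, while (1+x)^3 Q tends
  to 0 and keeps the inner exponential harmless. What decays only polynomially is exp(1/x)/x from
  smoothing and x^(1-p), up to a constant, from truncation.\<close>

lemma tail_error_tendsto_0:
  assumes p: "2 < p" and B: "0 < B"
  shows "(tail_error p B \<longlongrightarrow> 0) at_top"
proof -
  \<comment> \<open>Since p > 2, the rate satisfies \<kappa> < 1/8, which decides which Gaussian
    term of \<open>Q\<close> decays more slowly.\<close>
  define \<kappa> where "\<kappa> = 1 / (4 * p)"
  have \<kappa>: "0 < \<kappa>" "\<kappa> < 1 / 8" using p by (simp_all add: \<kappa>_def field_simps)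
  define Q where "Q x = 120 * exp (- (\<kappa> * x\<^sup>2)) + 2 * B * (x / 8) ^ 3 * exp (- x\<^sup>2 / 8)" for x :: real
  have 1: "((\<lambda>x::real. exp (1 / x) / x) \<longlongrightarrow> 0) at_top" by real_asymp
  have 2: "((\<lambda>x. (1 + x) ^ 3 * Q x) \<longlongrightarrow> 0) at_top" unfolding Q_def using \<kappa> B by real_asymp
  have 3: "((\<lambda>x. 3360 * x ^ 7 * exp (1 / x) * Q x) \<longlongrightarrow> 0) at_top" unfolding Q_def using \<kappa> B by real_asymp
  have 4: "((\<lambda>x. B * (x * (x / 8) powr (- p))) \<longlongrightarrow> 0) at_top" using p B by real_asymp
  have "((\<lambda>x. exp (1 / x) / x + 3360 * x ^ 7 * exp (1 / x) * Q x * exp ((1 + x) ^ 3 * Q x) + B * (x * (x / 8) powr (- p))) \<longlongrightarrow>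
      0 + 0 * exp 0 + 0) at_top"
    by (intro tendsto_intros 1 2 3 4)
  then have "((\<lambda>x. exp (1 / x) / x + 3360 * x ^ 7 * exp (1 / x) * Q x * exp ((1 + x) ^ 3 * Q x) + B * (x * (x / 8) powr (- p))) \<longlongrightarrow> 0) at_top"
    by simp
  moreover have "\<forall>\<^sub>F x in at_top. exp (1 / x) / x + 3360 * x ^ 7 * exp (1 / x) * Q x * exp ((1 + x) ^ 3 * Q x) + B * (x * (x / 8) powr (- p)) = tail_error p B x"
    using eventually_gt_at_top[of 0]
  proof eventually_elim
    case (elim x)
    have "tail_error p B x = x * (exp (1 / x) / x\<^sup>2 + 840 * x ^ 6 * exp (1 / x) * exp ((1 + x) ^ 3 * Q x) * (4 * Q x) + B * (x / 8) powr (- p))"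
      by (simp add: tail_error_def Q_def \<kappa>_def Let_def)
    also have "\<dots> = x * (exp (1 / x) / x\<^sup>2) + 3360 * (x ^ 6 * x) * exp (1 / x) * Q x * exp ((1 + x) ^ 3 * Q x) + B * (x * (x / 8) powr (- p))"
      by (simp only: distrib_left mult_ac)
    also have "x * (exp (1 / x) / x\<^sup>2) = exp (1 / x) / x" using elim by (simp add: power2_eq_square)
    also have "x ^ 6 * x = x ^ 7" by (simp add: eval_nat_numeral)
    finally show ?case by simp
  qed
  ultimately show ?thesis by (rule Lim_transform_eventually)
qed

text \<open>The hypotheses on \<open>x\<close> say that y \<ge> 1 and h \<tau> \<le> 1 for the
  chosen parameters. With h = x the Chernoff factors -h(x-\<delta>) + h^2/2 combine to -x^2/2 + 1/x,
  so exp(-x^2/2) can be taken out of all three error terms.\<close>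

lemma large_deviation_bound:
  assumes N: "normalized_sum M I X s p B (exp (- x\<^sup>2 / (4 * p)))"
    and x: "8 \<le> x" "x * exp (- x\<^sup>2 / (4 * p)) \<le> 1"
  shows "\<bar>measure M {\<omega> \<in> space M. x \<le> (\<Sum>i\<in>I. X i \<omega>)} - normal_tail x\<bar> \<le> exp (- x\<^sup>2 / 2) / x * tail_error p B x"
proof -
  interpret normalized_sum M I X s p B "exp (- x\<^sup>2 / (4 * p))" by (rule N)
  define \<tau> where "\<tau> = exp (- x\<^sup>2 / (4 * p))"
  define Q where "Q = 120 * exp (- x\<^sup>2 / (4 * p)) + 2 * B * (x / 8) ^ 3 * exp (- x\<^sup>2 / 8)"
  have \<tau>p: "\<tau> powr p = exp (- x\<^sup>2 / 4)" "\<tau> powr (2 * p) = exp (- x\<^sup>2 / 2)"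
    using p by (simp_all add: \<tau>_def exp_powr_real)
  \<comment> \<open>The choice y = x/8 pays off here: the weight exp(h y) = exp(x^2/8) uses up only
    half of the decay exp(-x^2/4) of \<tau>^p.\<close>
  have "exp (x * (x / 8)) * exp (- x\<^sup>2 / 4) = exp (- x\<^sup>2 / 8)"
    unfolding exp_add[symmetric] by (simp add: power2_eq_square)
  then have "\<tau> powr p * exp (x * (x / 8)) = exp (- x\<^sup>2 / 8)" by (simp only: \<tau>p mult.commute)
  moreover have "clt_error p B x (x / 8) \<tau> = 120 * \<tau> + 2 * B * (x / 8) ^ 3 * (\<tau> powr p * exp (x * (x / 8)))"
    by (simp add: clt_error_def)
  ultimately have Q: "clt_error p B x (x / 8) \<tau> = Q"
    by (simp only: Q_def \<tau>_def)
  have x2: "1 / x\<^sup>2 \<le> 1" using x by (simp add: one_le_power)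
  have 1: "\<bar>x\<bar> * (1 / x\<^sup>2) = 1 / x" using x by (simp add: power2_eq_square)
  have 2: "840 / (1 / x\<^sup>2) ^ 3 = 840 * x ^ 6" by (simp add: power_divide power_mult[symmetric])
  have 3: "- x * (x - 1 / x\<^sup>2) + (x\<^sup>2 / 2 + (1 + x) ^ 3 * Q) = - x\<^sup>2 / 2 + 1 / x + (1 + x) ^ 3 * Q"
    using x by (simp add: field_simps power2_eq_square)
  have "\<bar>measure M {\<omega> \<in> space M. x \<le> (\<Sum>i\<in>I. X i \<omega>)} - normal_tail x\<bar> \<le>
     1 / x\<^sup>2 * exp (- x\<^sup>2 / 2 + \<bar>x\<bar> * (1 / x\<^sup>2)) +
     840 / (1 / x\<^sup>2) ^ 3 * exp (- x * (x - 1 / x\<^sup>2)) * exp (x\<^sup>2 / 2 + (1 + x) ^ 3 * Q) * (4 * Q) +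
     B * \<tau> powr (2 * p) * (x / 8) powr (- p)"
    unfolding Q[symmetric] \<tau>_def by (rule tail_approximation) (use x x2 in auto)
  also have "\<dots> = 1 / x\<^sup>2 * exp (- x\<^sup>2 / 2 + 1 / x) + 840 * x ^ 6 * exp (- x\<^sup>2 / 2 + 1 / x + (1 + x) ^ 3 * Q) * (4 * Q) +
     B * exp (- x\<^sup>2 / 2) * (x / 8) powr (- p)"
    unfolding 1 2 \<tau>p mult.assoc[of _ "exp _" "exp _"] exp_add[symmetric] 3 ..
  also have "\<dots> = exp (- x\<^sup>2 / 2) * (exp (1 / x) / x\<^sup>2 + 840 * x ^ 6 * exp (1 / x) * exp ((1 + x) ^ 3 * Q) * (4 * Q) + B * (x / 8) powr (- p))"
    unfolding exp_add by (simp add: algebra_simps)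
  also have "\<dots> = exp (- x\<^sup>2 / 2) / x * tail_error p B x"
    using x by (simp add: tail_error_def Q_def Let_def)
  finally show ?thesis .
qed

text \<open>Bounded levels: here \<open>h = 0\<close>, \<open>y = 1\<close> and \<open>\<delta>\<close> stays fixed while \<open>\<tau>\<close> tends to \<open>0\<close>.\<close>
definition clt_bound :: "real \<Rightarrow> real \<Rightarrow> real \<Rightarrow> real \<Rightarrow> real" where
  "clt_bound p B \<delta> \<tau> = (let Q = 120 * \<tau> + 2 * B * \<tau> powr p in 840 / \<delta> ^ 3 * exp Q * (4 * Q) + B * \<tau> powr (2 * p))"

lemma clt_bound_tendsto_0:
  assumes p: "2 < p"
  shows "(clt_bound p B \<delta> \<longlongrightarrow> 0) (at_right 0)"
proof -
  have q: "((\<lambda>\<tau>. \<tau> powr r) \<longlongrightarrow> 0) (at_right 0)" if "r > 0" for r :: real using that by real_asymp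
  define Q where "Q \<tau> = 120 * \<tau> + 2 * B * \<tau> powr p" for \<tau> :: real
  have "(Q \<longlongrightarrow> 120 * 0 + 2 * B * 0) (at_right 0)"
    unfolding Q_def by (intro tendsto_intros q) (use p in auto)
  then have "(Q \<longlongrightarrow> 0) (at_right 0)" by simp
  then have "((\<lambda>\<tau>. 840 / \<delta> ^ 3 * exp (Q \<tau>) * (4 * Q \<tau>) + B * \<tau> powr (2 * p)) \<longlongrightarrow> 840 / \<delta> ^ 3 * exp 0 * (4 * 0) + B * 0) (at_right 0)"
    by (intro tendsto_intros q) (use p in auto)
  moreover have "840 / \<delta> ^ 3 * exp 0 * (4 * 0) + B * 0 = 0" by simp
  moreover have "clt_bound p B \<delta> = (\<lambda>\<tau>. 840 / \<delta> ^ 3 * exp (Q \<tau>) * (4 * Q \<tau>) + B * \<tau> powr (2 * p))"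
    by (simp add: fun_eq_iff clt_bound_def Q_def Let_def)
  ultimately show ?thesis by (simp only:)
qed

lemma uniform_clt_bound:
  assumes N: "normalized_sum M I X s p B \<tau>" and \<delta>: "0 < \<delta>" "\<delta> \<le> 1"
  shows "\<bar>measure M {\<omega> \<in> space M. x \<le> (\<Sum>i\<in>I. X i \<omega>)} - normal_tail x\<bar> \<le> 3 * \<delta> + clt_bound p B \<delta> \<tau>"
proof -
  interpret normalized_sum M I X s p B \<tau> by (rule N)
  have "\<bar>measure M {\<omega> \<in> space M. x \<le> (\<Sum>i\<in>I. X i \<omega>)} - normal_tail x\<bar> \<le>
     \<delta> * exp (- x\<^sup>2 / 2 + \<bar>x\<bar> * \<delta>) +
     840 / \<delta> ^ 3 * exp (- 0 * (x - \<delta>)) * exp (0\<^sup>2 / 2 + (1 + 0) ^ 3 * clt_error p B 0 1 \<tau>) * (4 * clt_error p B 0 1 \<tau>) +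
     B * \<tau> powr (2 * p) * 1 powr (- p)"
    by (rule tail_approximation) (use \<delta> in auto)
  also have "\<dots> = \<delta> * exp (- x\<^sup>2 / 2 + \<bar>x\<bar> * \<delta>) + clt_bound p B \<delta> \<tau>"
    by (simp add: clt_bound_def clt_error_def Let_def)
  also have "exp (- x\<^sup>2 / 2 + \<bar>x\<bar> * \<delta>) \<le> 3"
  proof -
    have "\<bar>x\<bar> * \<delta> \<le> \<bar>x\<bar>" using \<delta> by (simp add: mult_left_le)
    \<comment> \<open>This gives |x| \<le> (x^2 + 1)/2, so the exponent is bounded uniformly in
      \<open>x\<close>.\<close>
    moreover have "0 \<le> (\<bar>x\<bar> - 1)\<^sup>2" by simp
    ultimately have "- x\<^sup>2 / 2 + \<bar>x\<bar> * \<delta> \<le> 1" by (simp add: power2_diff)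
    then have "exp (- x\<^sup>2 / 2 + \<bar>x\<bar> * \<delta>) \<le> exp 1" by (simp only: exp_le_cancel_iff)
    then show ?thesis using exp_le by linarith
  qed
  finally show ?thesis using \<delta> by (simp add: mult.commute mult_left_mono)
qed

text \<open>The threshold \<eta> is uniform in the space, the summands and \<open>x\<close>, so it
  serves all rows of the array at once. The premise leaves \<tau> free because the two regimes use
  different values: one tied to \<open>x\<close> for large levels, one tied to \<open>D\<close>
  otherwise.\<close>

lemma normalized_sum_tail_ratio:
  assumes p: "2 < p" and B: "0 < B" and \<epsilon>: "0 < (\<epsilon>::real)"
  shows "\<exists>\<eta>>0. \<forall>(M::'a measure) (I::'i set) X s D x.
    (\<forall>\<tau>. 0 < \<tau> \<longrightarrow> \<tau> \<le> 1 \<longrightarrow> D \<le> \<tau> powr (2 * p) \<longrightarrow> normalized_sum M I X s p B \<tau>) \<longrightarrow>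
    0 < D \<longrightarrow> D \<le> \<eta> \<longrightarrow> D \<le> exp (- x\<^sup>2 / 2) \<longrightarrow>
    \<bar>measure M {\<omega> \<in> space M. x \<le> (\<Sum>i\<in>I. X i \<omega>)} - normal_tail x\<bar> \<le> \<epsilon> * normal_tail x"
proof -
  define c where "c = exp (- 3 / 2) / sqrt (2 * pi)"
  have c: "0 < c" by (simp add: c_def)
  have "\<forall>\<^sub>F x in at_top. tail_error p B x < \<epsilon> * c"
    by (rule order_tendstoD(2)[OF tail_error_tendsto_0[OF p B]]) (use \<epsilon> c in auto)
  moreover have "((\<lambda>x::real. x * exp (- (\<kappa> * x\<^sup>2))) \<longlongrightarrow> 0) at_top" if "0 < \<kappa>" for \<kappa>
    using that by real_asymp
  from this[of "1 / (4 * p)"] p have "((\<lambda>x::real. x * exp (- x\<^sup>2 / (4 * p))) \<longlongrightarrow> 0) at_top" by simp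
  then have "\<forall>\<^sub>F x::real in at_top. x * exp (- x\<^sup>2 / (4 * p)) < 1" by (rule order_tendstoD) simp
  ultimately have "\<forall>\<^sub>F x in at_top. tail_error p B x < \<epsilon> * c \<and> x * exp (- x\<^sup>2 / (4 * p)) < 1"
    by eventually_elim auto
  then obtain X0 where X0: "\<And>x. X0 \<le> x \<Longrightarrow> tail_error p B x < \<epsilon> * c \<and> x * exp (- x\<^sup>2 / (4 * p)) < 1"
    unfolding eventually_at_top_linorder by blast
  define X1 where "X1 = max 8 X0"
  \<comment> \<open>For levels below \<open>X1\<close> the normal tail is at least its value at
    \<open>X1\<close>, so an absolute error of \<open>t\<close> is a relative error of at most
    \<epsilon>. Smoothing and replacement receive one half of \<open>t\<close> each.\<close>
  define t where "t = \<epsilon> * normal_tail X1"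
  have t: "0 < t" using \<epsilon> normal_tail_pos by (simp add: t_def)
  define \<delta> where "\<delta> = min 1 (t / 6)"
  have \<delta>: "0 < \<delta>" "\<delta> \<le> 1" "3 * \<delta> \<le> t / 2" using t by (auto simp: \<delta>_def)
  have "\<forall>\<^sub>F \<tau> in at_right 0. clt_bound p B \<delta> \<tau> < t / 2"
    by (rule order_tendstoD(2)[OF clt_bound_tendsto_0[OF p]]) (use t in auto)
  then obtain \<tau>0 where \<tau>0: "0 < \<tau>0" "\<And>\<tau>. 0 < \<tau> \<Longrightarrow> \<tau> < \<tau>0 \<Longrightarrow> clt_bound p B \<delta> \<tau> < t / 2"
    unfolding eventually_at_right_field by auto
  \<comment> \<open>With this value, D \<le> \<eta> forces the (2p)-th root of \<open>D\<close> to
    be at most 1 and strictly below \<open>\<tau>0\<close>.\<close>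
  define \<eta> where "\<eta> = (min 1 (\<tau>0 / 2)) powr (2 * p)"
  have \<eta>: "0 < \<eta>" using \<tau>0 by (simp add: \<eta>_def)
  show ?thesis
  proof (intro exI[of _ \<eta>] conjI allI impI \<eta>)
    fix M :: "'a measure" and I :: "'i set" and X s D x
    assume N: "\<forall>\<tau>. 0 < \<tau> \<longrightarrow> \<tau> \<le> 1 \<longrightarrow> D \<le> \<tau> powr (2 * p) \<longrightarrow> normalized_sum M I X s p B \<tau>"
      and D: "0 < D" "D \<le> \<eta>" "D \<le> exp (- x\<^sup>2 / 2)"
    show "\<bar>measure M {\<omega> \<in> space M. x \<le> (\<Sum>i\<in>I. X i \<omega>)} - normal_tail x\<bar> \<le> \<epsilon> * normal_tail x"
    proof (cases "X1 \<le> x")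
      case True
      then have x: "8 \<le> x" "X0 \<le> x" by (auto simp: X1_def)
      \<comment> \<open>The restriction D \<le> exp(-x^2/2) on the level says exactly that this
        \<tau> is admissible.\<close>
      have "exp (- x\<^sup>2 / (4 * p)) powr (2 * p) = exp (- x\<^sup>2 / 2)"
        using p by (simp add: exp_powr_real)
      then have "normalized_sum M I X s p B (exp (- x\<^sup>2 / (4 * p)))"
        using N D p by auto
      then have "\<bar>measure M {\<omega> \<in> space M. x \<le> (\<Sum>i\<in>I. X i \<omega>)} - normal_tail x\<bar> \<le> exp (- x\<^sup>2 / 2) / x * tail_error p B x"
        by (rule large_deviation_bound) (use x X0[of x] in auto)
      also have "\<dots> \<le> exp (- x\<^sup>2 / 2) / x * (\<epsilon> * c)"
        using X0[of x] x by (intro mult_left_mono) auto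
      also have "\<dots> = \<epsilon> * (c * (exp (- x\<^sup>2 / 2) / x))" by simp
      also have "\<dots> \<le> \<epsilon> * normal_tail x"
        unfolding c_def using \<epsilon> x by (intro mult_left_mono normal_tail_lower_bound) auto
      finally show ?thesis .
    next
      case False
      \<comment> \<open>Levels below \<open>X1\<close>, including negative ones: take the smallest
        \<tau> that \<open>D\<close> admits and use the uniform bound with h = 0.\<close>
      define \<tau> where "\<tau> = D powr (1 / (2 * p))"
      have "\<tau> \<le> \<eta> powr (1 / (2 * p))" unfolding \<tau>_def using D p by (intro powr_mono2) auto
      also have "\<dots> = min 1 (\<tau>0 / 2)" using p \<tau>0 by (simp add: \<eta>_def powr_powr)
      finally have \<tau>: "0 < \<tau>" "\<tau> \<le> 1" "\<tau> < \<tau>0" using D \<tau>0 by (auto simp: \<tau>_def)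
      have "\<tau> powr (2 * p) = D" using D p by (simp add: \<tau>_def powr_powr)
      then have "normalized_sum M I X s p B \<tau>" using N \<tau> by simp
      then have "\<bar>measure M {\<omega> \<in> space M. x \<le> (\<Sum>i\<in>I. X i \<omega>)} - normal_tail x\<bar> \<le> 3 * \<delta> + clt_bound p B \<delta> \<tau>"
        by (rule uniform_clt_bound) (use \<delta> in auto)
      also have "\<dots> \<le> t" using \<delta>(3) \<tau>0(2)[OF \<tau>(1,3)] by linarith
      also have "\<dots> \<le> \<epsilon> * normal_tail x"
        unfolding t_def using False \<epsilon> by (intro mult_left_mono normal_tail_antimono) auto
      finally show ?thesis .
    qed
  qed
qed

section \<open>Weighted sums of i.i.d. variables\<close>

lemma (in prob_space) square_integral_indep_sum:
  fixes X :: "'i \<Rightarrow> 'a \<Rightarrow> real"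
  assumes I: "finite I" and ind: "indep_vars (\<lambda>_. borel) X I"
    and i: "\<And>i. i \<in> I \<Longrightarrow> integrable M (X i)" "\<And>i. i \<in> I \<Longrightarrow> integrable M (\<lambda>\<omega>. (X i \<omega>)\<^sup>2)"
    and e: "\<And>i. i \<in> I \<Longrightarrow> expectation (X i) = 0"
  shows "integrable M (\<lambda>\<omega>. (\<Sum>i\<in>I. X i \<omega>)\<^sup>2) \<and>
    expectation (\<lambda>\<omega>. (\<Sum>i\<in>I. X i \<omega>)\<^sup>2) = (\<Sum>i\<in>I. expectation (\<lambda>\<omega>. (X i \<omega>)\<^sup>2))"
  using assms
proof (induction I rule: finite_induct)
  case (insert j J)
  define S where "S \<omega> = (\<Sum>i\<in>J. X i \<omega>)" for \<omega>
  have J: "integrable M (\<lambda>\<omega>. (S \<omega>)\<^sup>2)" "expectation (\<lambda>\<omega>. (S \<omega>)\<^sup>2) = (\<Sum>i\<in>J. expectation (\<lambda>\<omega>. (X i \<omega>)\<^sup>2))"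
    using insert.IH[OF indep_vars_subset[OF insert.prems(1)]] insert.prems by (auto simp: S_def)
  have S: "integrable M S" unfolding S_def using insert.prems by auto
  have indS: "indep_var borel (X j) borel S"
    unfolding S_def using insert by (intro indep_vars_sum) auto
  have Xj: "integrable M (X j)" "integrable M (\<lambda>\<omega>. (X j \<omega>)\<^sup>2)" "expectation (X j) = 0"
    using insert.prems by auto
  have XS: "integrable M (\<lambda>\<omega>. X j \<omega> * S \<omega>)" "expectation (\<lambda>\<omega>. X j \<omega> * S \<omega>) = 0"
    using indep_var_integrable[OF indS Xj(1) S] indep_var_lebesgue_integral[OF indS Xj(1) S] Xj by auto
  have "(\<Sum>i\<in>insert j J. X i \<omega>)\<^sup>2 = (X j \<omega>)\<^sup>2 + (S \<omega>)\<^sup>2 + 2 * (X j \<omega> * S \<omega>)" for \<omega>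
    using insert(1,2) by (simp add: S_def power2_sum)
  then show ?case using J Xj XS insert(1,2) by simp
qed simp

lemma integral_identically_distributed:
  assumes "distr M borel X = distr M borel Y" and [measurable]: "X \<in> borel_measurable M" "Y \<in> borel_measurable M"
    and g: "g \<in> borel_measurable borel"
  shows "integrable M (\<lambda>\<omega>. g (X \<omega>) :: real) \<longleftrightarrow> integrable M (\<lambda>\<omega>. g (Y \<omega>))"
    and "(\<integral>\<omega>. g (X \<omega>) \<partial>M) = (\<integral>\<omega>. g (Y \<omega>) \<partial>M :: real)"
  using integrable_distr_eq[OF assms(2) g] integrable_distr_eq[OF assms(3) g]
    integral_distr[OF assms(2) g] integral_distr[OF assms(3) g] assms(1) by simp_all

locale iid_moments = prob_space M for M :: "'a measure" +
  fixes \<xi> :: "int \<Rightarrow> 'a \<Rightarrow> real" and p :: real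
  assumes iid: "iid_rvs M \<xi>"
    and square_integrable: "integrable M (\<lambda>\<omega>. (\<xi> 0 \<omega>)\<^sup>2)" and centered: "expectation (\<xi> 0) = 0"
    and variance_pos: "0 < expectation (\<lambda>\<omega>. (\<xi> 0 \<omega>)\<^sup>2)" and p: "2 < p"
    and powr_integrable: "integrable M (\<lambda>\<omega>. \<bar>\<xi> 0 \<omega>\<bar> powr p)"
begin

definition std_dev where "std_dev = sqrt (expectation (\<lambda>\<omega>. (\<xi> 0 \<omega>)\<^sup>2))"

text \<open>This is the \<open>p\<close>-th absolute moment of the standardized variable.\<close>

definition beta where "beta = expectation (\<lambda>\<omega>. \<bar>\<xi> 0 \<omega>\<bar> powr p) / std_dev powr p"

lemma std_dev_pos: "0 < std_dev" using variance_pos by (simp add: std_dev_def)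

lemma std_dev_square: "expectation (\<lambda>\<omega>. (\<xi> 0 \<omega>)\<^sup>2) = std_dev\<^sup>2"
  using variance_pos by (simp add: std_dev_def)

lemma beta_nonneg: "0 \<le> beta"
  unfolding beta_def by (intro divide_nonneg_nonneg integral_nonneg_AE) auto

lemma \<xi>_measurable[measurable]: "\<xi> j \<in> borel_measurable M"
  using iid by (auto simp: iid_rvs_def indep_vars_def)

lemma \<xi>_distr: "distr M borel (\<xi> j) = distr M borel (\<xi> 0)"
  using iid unfolding iid_rvs_def by blast

lemma \<xi>_moments:
  "integrable M (\<xi> j)" "integrable M (\<lambda>\<omega>. (\<xi> j \<omega>)\<^sup>2)" "integrable M (\<lambda>\<omega>. \<bar>\<xi> j \<omega>\<bar> powr p)"
  "expectation (\<xi> j) = 0" "expectation (\<lambda>\<omega>. (\<xi> j \<omega>)\<^sup>2) = std_dev\<^sup>2"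
  "expectation (\<lambda>\<omega>. \<bar>\<xi> j \<omega>\<bar> powr p) = beta * std_dev powr p"
proof -
  have D: "integrable M (\<lambda>\<omega>. g (\<xi> j \<omega>)) \<longleftrightarrow> integrable M (\<lambda>\<omega>. g (\<xi> 0 \<omega>))"
      "expectation (\<lambda>\<omega>. g (\<xi> j \<omega>)) = expectation (\<lambda>\<omega>. g (\<xi> 0 \<omega>))"
    if "g \<in> borel_measurable borel" for g :: "real \<Rightarrow> real"
    by (rule integral_identically_distributed[OF \<xi>_distr \<xi>_measurable \<xi>_measurable that])+
  show i2: "integrable M (\<lambda>\<omega>. (\<xi> j \<omega>)\<^sup>2)"
    using D(1)[of "\<lambda>v. v\<^sup>2"] square_integrable by simp
  then show "integrable M (\<xi> j)" by (rule square_integrable_imp_integrable[OF \<xi>_measurable])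
  show "integrable M (\<lambda>\<omega>. \<bar>\<xi> j \<omega>\<bar> powr p)"
    using D(1)[of "\<lambda>v. \<bar>v\<bar> powr p"] powr_integrable by simp
  show "expectation (\<xi> j) = 0" using D(2)[of "\<lambda>v. v"] centered by simp
  show "expectation (\<lambda>\<omega>. (\<xi> j \<omega>)\<^sup>2) = std_dev\<^sup>2"
    using D(2)[of "\<lambda>v. v\<^sup>2"] std_dev_square by simp
  show "expectation (\<lambda>\<omega>. \<bar>\<xi> j \<omega>\<bar> powr p) = beta * std_dev powr p"
    using D(2)[of "\<lambda>v. \<bar>v\<bar> powr p"] std_dev_pos by (simp add: beta_def)
qed

lemma indep_scaled: "indep_vars (\<lambda>_. borel) (\<lambda>i \<omega>. a i * \<xi> (int i) \<omega>) I"
proof -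
  have "indep_vars (\<lambda>_. borel) \<xi> (int ` I)"
    using iid indep_vars_subset unfolding iid_rvs_def by blast
  then have "indep_vars (\<lambda>_. borel) (\<lambda>i. \<xi> (int i)) I"
    by (rule indep_vars_reindex_inj) simp
  then show ?thesis by (rule indep_vars_compose2) simp
qed

lemma weighted_sum_sd_eq: "weighted_sum_sd M c k \<xi> n = std_dev * sqrt (\<Sum>i=1..k n. (c n i)\<^sup>2)"
proof -
  have e: "expectation (\<lambda>\<omega>. c n i * \<xi> (int i) \<omega>) = 0" for i using \<xi>_moments by simp
  have E: "expectation (weighted_sum c k \<xi> n) = 0"
    unfolding weighted_sum_def[abs_def] using \<xi>_moments by simp
  have "expectation (\<lambda>\<omega>. (\<Sum>i=1..k n. c n i * \<xi> (int i) \<omega>)\<^sup>2) = (\<Sum>i=1..k n. expectation (\<lambda>\<omega>. (c n i * \<xi> (int i) \<omega>)\<^sup>2))"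
    by (rule square_integral_indep_sum[THEN conjunct2, OF _ indep_scaled])
      (use \<xi>_moments e in \<open>auto simp: power_mult_distrib\<close>)
  also have "\<dots> = std_dev\<^sup>2 * (\<Sum>i=1..k n. (c n i)\<^sup>2)"
    using \<xi>_moments by (simp add: power_mult_distrib sum_distrib_left mult.commute)
  finally show ?thesis
    using std_dev_pos by (simp add: weighted_sum_sd_def E weighted_sum_def real_sqrt_mult)
qed

section \<open>Normalization of a single row of coefficients\<close>

context
  fixes c :: "nat \<Rightarrow> nat \<Rightarrow> real" and k :: "nat \<Rightarrow> nat" and n :: nat
  assumes nonzero: "\<exists>i\<in>{1..k n}. c n i \<noteq> 0"
begin

definition "row_norm = sqrt (\<Sum>i=1..k n. (c n i)\<^sup>2)"
text \<open>Zero coefficients are dropped because \<open>normalized_sum\<close> asks for strictly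
  positive standard deviations, which the normal partners need for a density. They contribute
  nothing to any of the sums.\<close>

definition "row_support = {i\<in>{1..k n}. c n i \<noteq> 0}"
definition "row_summand i \<omega> = c n i / (std_dev * row_norm) * \<xi> (int i) \<omega>"
definition "row_sd i = \<bar>c n i\<bar> / row_norm"

lemma row_norm_pos: "0 < row_norm"
proof -
  obtain i where i: "i \<in> {1..k n}" "c n i \<noteq> 0" using nonzero by blast
  have "0 < (c n i)\<^sup>2" using i by simp
  also have "\<dots> \<le> (\<Sum>i=1..k n. (c n i)\<^sup>2)" using i by (intro member_le_sum) auto
  finally show ?thesis by (simp add: row_norm_def)
qed

lemma row_norm_square: "(\<Sum>i=1..k n. (c n i)\<^sup>2) = row_norm\<^sup>2"
  by (simp add: row_norm_def sum_nonneg)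

lemma sum_row_sd_square: "(\<Sum>i\<in>row_support. (row_sd i)\<^sup>2) = 1"
proof -
  have "(\<Sum>i\<in>row_support. (row_sd i)\<^sup>2) = (\<Sum>i=1..k n. (row_sd i)\<^sup>2)"
    by (rule sum.mono_neutral_left) (auto simp: row_support_def row_sd_def)
  also have "\<dots> = (\<Sum>i=1..k n. (c n i)\<^sup>2) / row_norm\<^sup>2"
    by (simp add: row_sd_def power_divide sum_divide_distrib)
  also have "\<dots> = 1" unfolding row_norm_square using row_norm_pos by simp
  finally show ?thesis .
qed

lemma lyapunov_ratio_eq: "lyapunov_ratio c k p n = (\<Sum>i\<in>row_support. row_sd i powr p)"
proof -
  have "(\<Sum>i=1..k n. (c n i)\<^sup>2) powr (- p / 2) = row_norm powr (- p)"
    unfolding row_norm_square using row_norm_pos by (simp add: powr_powr flip: powr_numeral)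
  then have "lyapunov_ratio c k p n = (\<Sum>i=1..k n. row_sd i powr p)"
    unfolding lyapunov_ratio_def using row_norm_pos
    by (simp add: row_sd_def powr_divide powr_minus_divide sum_divide_distrib)
  also have "\<dots> = (\<Sum>i\<in>row_support. row_sd i powr p)"
    by (rule sum.mono_neutral_right) (auto simp: row_support_def row_sd_def)
  finally show ?thesis .
qed

lemma row_sd_pos: "i \<in> row_support \<Longrightarrow> 0 < row_sd i"
  using row_norm_pos by (simp add: row_support_def row_sd_def)

lemma row_support: "finite row_support" "row_support \<noteq> {}" "row_support \<subseteq> {1..k n}"
  using nonzero by (auto simp: row_support_def)

lemma lyapunov_ratio_pos: "0 < lyapunov_ratio c k p n"
  unfolding lyapunov_ratio_eq using row_support(1,2) by (rule sum_pos) (use row_sd_pos in force)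

text \<open>Write a^p = a^2 (a^2)^((p-2)/2) for the normalized coefficients a, bound the second
  factor by the maximum and use that the squares sum to 1. So uniformly negligible coefficients
  force the Lyapunov ratio to 0.\<close>

lemma lyapunov_ratio_le:
  "lyapunov_ratio c k p n \<le> (std_dev\<^sup>2 * ((MAX i\<in>{1..k n}. (c n i)\<^sup>2) / (weighted_sum_sd M c k \<xi> n)\<^sup>2)) powr ((p - 2) / 2)"
proof -
  define m where "m = std_dev\<^sup>2 * ((MAX i\<in>{1..k n}. (c n i)\<^sup>2) / (weighted_sum_sd M c k \<xi> n)\<^sup>2)"
  have m: "m = (MAX i\<in>{1..k n}. (c n i)\<^sup>2) / row_norm\<^sup>2"
    using std_dev_pos row_norm_square row_norm_pos
    by (simp add: m_def weighted_sum_sd_eq power_mult_distrib row_norm_def[symmetric])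
  have "row_sd i powr p \<le> (row_sd i)\<^sup>2 * m powr ((p - 2) / 2)" if i: "i \<in> row_support" for i
  proof -
    have "(row_sd i)\<^sup>2 \<le> m"
      unfolding m row_sd_def power_divide using i row_support(3) by (intro divide_right_mono) auto
    then have "((row_sd i)\<^sup>2) powr ((p - 2) / 2) \<le> m powr ((p - 2) / 2)" using p by (intro powr_mono2) auto
    moreover have "((row_sd i)\<^sup>2) powr ((p - 2) / 2) = row_sd i powr (p - 2)"
    proof -
      have "2 * ((p - 2) / 2) = p - 2" by simp
      then have "(row_sd i powr 2) powr ((p - 2) / 2) = row_sd i powr (p - 2)" by (simp only: powr_powr)
      then show ?thesis using row_sd_pos[OF i] by simp
    qed
    moreover have "row_sd i powr p = (row_sd i)\<^sup>2 * row_sd i powr (p - 2)"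
      using row_sd_pos[OF i] powr_add[of "row_sd i" 2 "p - 2"] by simp
    ultimately show ?thesis by (simp add: mult_left_mono)
  qed
  then have "lyapunov_ratio c k p n \<le> (\<Sum>i\<in>row_support. (row_sd i)\<^sup>2 * m powr ((p - 2) / 2))"
    unfolding lyapunov_ratio_eq by (rule sum_mono)
  also have "\<dots> = m powr ((p - 2) / 2)"
    by (simp add: sum_distrib_right[symmetric] sum_row_sd_square)
  finally show ?thesis by (simp add: m_def)
qed

text \<open>After normalization the \<open>p\<close>-th moments add up to \<open>beta\<close> times
  the Lyapunov ratio. Taking \<open>beta + 1\<close> provides a positive constant, as
  \<open>normalized_sum_tail_ratio\<close> requires, that does not depend on the row.\<close>

lemma normalized_sum_row:
  assumes \<tau>: "0 < \<tau>" "\<tau> \<le> 1" "lyapunov_ratio c k p n \<le> \<tau> powr (2 * p)"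
  shows "normalized_sum M row_support row_summand row_sd p (beta + 1) \<tau>"
proof
  show "indep_vars (\<lambda>_. borel) row_summand row_support"
    unfolding row_summand_def[abs_def] by (rule indep_scaled)
  have summand: "row_summand i = (\<lambda>\<omega>. c n i / (std_dev * row_norm) * \<xi> (int i) \<omega>)" for i
    by (simp add: fun_eq_iff row_summand_def)
  show "integrable M (row_summand i)" "expectation (row_summand i) = 0" for i
    unfolding summand using \<xi>_moments by auto
  have sq: "(row_summand i \<omega>)\<^sup>2 = (c n i / (std_dev * row_norm))\<^sup>2 * (\<xi> (int i) \<omega>)\<^sup>2" for i \<omega>
    unfolding row_summand_def power_mult_distrib ..
  show "integrable M (\<lambda>\<omega>. (row_summand i \<omega>)\<^sup>2)" for i
    unfolding sq using \<xi>_moments by auto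
  show "expectation (\<lambda>\<omega>. (row_summand i \<omega>)\<^sup>2) = (row_sd i)\<^sup>2" for i
    unfolding sq using \<xi>_moments std_dev_pos row_norm_pos
    by (simp add: row_sd_def power_divide power_mult_distrib)
  have pw: "\<bar>row_summand i \<omega>\<bar> powr p = (row_sd i / std_dev) powr p * \<bar>\<xi> (int i) \<omega>\<bar> powr p" for i \<omega>
  proof -
    have "\<bar>row_summand i \<omega>\<bar> = row_sd i / std_dev * \<bar>\<xi> (int i) \<omega>\<bar>"
      using std_dev_pos row_norm_pos by (simp add: row_summand_def row_sd_def abs_mult)
    moreover have "0 \<le> row_sd i / std_dev" using std_dev_pos row_norm_pos by (simp add: row_sd_def)
    ultimately show ?thesis by (simp only: powr_mult abs_ge_zero)
  qed
  show "integrable M (\<lambda>\<omega>. \<bar>row_summand i \<omega>\<bar> powr p)" for i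
    unfolding pw using \<xi>_moments by auto
  have "expectation (\<lambda>\<omega>. \<bar>row_summand i \<omega>\<bar> powr p) = beta * row_sd i powr p" for i
    unfolding pw using \<xi>_moments std_dev_pos row_norm_pos by (simp add: powr_divide powr_mult row_sd_def)
  then have "(\<Sum>i\<in>row_support. expectation (\<lambda>\<omega>. \<bar>row_summand i \<omega>\<bar> powr p)) = beta * lyapunov_ratio c k p n"
    by (simp add: lyapunov_ratio_eq sum_distrib_left)
  also have "\<dots> \<le> (beta + 1) * \<tau> powr (2 * p)"
    using \<tau> beta_nonneg lyapunov_ratio_pos by (intro mult_mono) auto
  finally show "(\<Sum>i\<in>row_support. expectation (\<lambda>\<omega>. \<bar>row_summand i \<omega>\<bar> powr p)) \<le> (beta + 1) * \<tau> powr (2 * p)" .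
  \<comment> \<open>One summand larger than \<tau> would alone push the Lyapunov ratio above
    \<tau>^p, which is at least \<tau>^(2p) because \<tau> \<le> 1.\<close>
  show "row_sd i \<le> \<tau>" if i: "i \<in> row_support" for i
  proof (rule ccontr)
    assume "\<not> row_sd i \<le> \<tau>"
    then have "\<tau> powr p < row_sd i powr p" using \<tau> p by (intro powr_less_mono2) auto
    also have "\<dots> \<le> lyapunov_ratio c k p n"
      unfolding lyapunov_ratio_eq using i row_support by (intro member_le_sum) auto
    also have "\<dots> \<le> \<tau> powr (2 * p)" by (rule \<tau>)
    also have "\<dots> \<le> \<tau> powr p" using \<tau> p by (intro powr_mono') auto
    finally show False by simp
  qed
  show "2 \<le> p" "0 \<le> beta + 1" using p beta_nonneg by simp_all
qed (fact row_support(1,2) row_sd_pos sum_row_sd_square \<tau>(1,2))+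

lemma weighted_sum_event:
  "{\<omega> \<in> space M. weighted_sum c k \<xi> n \<omega> \<ge> x * weighted_sum_sd M c k \<xi> n} =
    {\<omega> \<in> space M. x \<le> (\<Sum>i\<in>row_support. row_summand i \<omega>)}"
proof -
  have pos: "0 < std_dev * row_norm" using std_dev_pos row_norm_pos by simp
  have "(\<Sum>i\<in>row_support. row_summand i \<omega>) = weighted_sum c k \<xi> n \<omega> / (std_dev * row_norm)" for \<omega>
  proof -
    have "(\<Sum>i\<in>row_support. row_summand i \<omega>) = (\<Sum>i=1..k n. row_summand i \<omega>)"
      by (rule sum.mono_neutral_left) (auto simp: row_support_def row_summand_def)
    then show ?thesis by (simp add: row_summand_def weighted_sum_def sum_divide_distrib)
  qed
  then have "x \<le> (\<Sum>i\<in>row_support. row_summand i \<omega>) \<longleftrightarrow> weighted_sum c k \<xi> n \<omega> \<ge> x * weighted_sum_sd M c k \<xi> n" for \<omega>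
    unfolding weighted_sum_sd_eq row_norm_def[symmetric] by (simp only: pos_le_divide_eq[OF pos])
  then show ?thesis by simp
qed

end

end

theorem theorem2p3:
  fixes M :: "'a measure"
    and \<xi> :: "int \<Rightarrow> 'a \<Rightarrow> real"
    and p :: real
    and k :: "nat \<Rightarrow> nat"
    and c :: "nat \<Rightarrow> nat \<Rightarrow> real"
    and x :: "nat \<Rightarrow> real"
  assumes "prob_space M"
    and "iid_rvs M \<xi>"
    and "integrable M (\<lambda>\<omega>. (\<xi> 0 \<omega>)\<^sup>2)"
    and "(\<integral>\<omega>. \<xi> 0 \<omega> \<partial>M) = 0"
    and "(\<integral>\<omega>. (\<xi> 0 \<omega>)\<^sup>2 \<partial>M) > 0"
    and "p > 2"
    and "integrable M (\<lambda>\<omega>. \<bar>\<xi> 0 \<omega>\<bar> powr p)"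
    and "\<forall>n\<ge>1. k n > 0"
    and "\<forall>n\<ge>1. \<exists>i\<in>{1..k n}. c n i \<noteq> 0"
    and "(\<lambda>n. (MAX i\<in>{1..k n}. (c n i)\<^sup>2) / (weighted_sum_sd M c k \<xi> n)\<^sup>2) \<longlonglongrightarrow> 0"
    and "\<forall>n\<ge>1. (x n)\<^sup>2 \<le> 2 * ln (inverse (lyapunov_ratio c k p n))"
  shows "\<exists>\<epsilon> :: nat \<Rightarrow> real. \<epsilon> \<longlonglongrightarrow> 0 \<and>
    (\<forall>n\<ge>1. measure M {\<omega> \<in> space M. weighted_sum c k \<xi> n \<omega> \<ge> x n * weighted_sum_sd M c k \<xi> n}
       = (1 - std_normal_cdf (x n)) * (1 + \<epsilon> n))"
proof -
  interpret prob_space M by fact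
  interpret iid_moments M \<xi> p by unfold_locales (use assms in auto)
  define P where "P n = measure M {\<omega> \<in> space M. weighted_sum c k \<xi> n \<omega> \<ge> x n * weighted_sum_sd M c k \<xi> n}" for n
  define D where "D n = lyapunov_ratio c k p n" for n
  have nz: "\<exists>i\<in>{1..k n}. c n i \<noteq> 0" if "1 \<le> n" for n using assms(9) that by blast
  have D0: "0 < D n" if "1 \<le> n" for n unfolding D_def by (rule lyapunov_ratio_pos[where c=c and k=k and n=n, OF nz[OF that]])
  have Dx: "D n \<le> exp (- (x n)\<^sup>2 / 2)" if n: "1 \<le> n" for n
  proof -
    have "(x n)\<^sup>2 \<le> 2 * ln (inverse (D n))" using assms(11) n by (simp add: D_def)
    then have "ln (D n) \<le> - (x n)\<^sup>2 / 2" using D0[OF n] by (simp add: ln_inverse)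
    then show ?thesis using D0[OF n] by (metis exp_le_cancel_iff exp_ln)
  qed
  have D_lim: "D \<longlonglongrightarrow> 0"
  proof -
    let ?m = "\<lambda>n. std_dev\<^sup>2 * ((MAX i\<in>{1..k n}. (c n i)\<^sup>2) / (weighted_sum_sd M c k \<xi> n)\<^sup>2)"
    have "?m \<longlonglongrightarrow> std_dev\<^sup>2 * 0" by (intro tendsto_intros assms(10))
    moreover have "\<forall>\<^sub>F n in sequentially. 0 \<le> ?m n"
      using eventually_ge_at_top[of 1]
    proof eventually_elim
      case (elim n)
      \<comment> \<open>The row must be nonempty for the maximum to be meaningful; this holds from n
        = 1 on.\<close>
      obtain i where "i \<in> {1..k n}" using nz[OF elim] by blast
      then have "0 \<le> (MAX i\<in>{1..k n}. (c n i)\<^sup>2)" by (intro order_trans[OF zero_le_power2[of "c n i"]] Max_ge) auto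
      then show ?case by simp
    qed
    ultimately have lim: "(\<lambda>n. ?m n powr ((p - 2) / 2)) \<longlonglongrightarrow> 0"
      by (intro tendsto_zero_powrI[where b="(p - 2) / 2"]) (use p in auto)
    have upper: "\<forall>\<^sub>F n in sequentially. D n \<le> ?m n powr ((p - 2) / 2)"
      using eventually_ge_at_top[of 1]
      by eventually_elim (unfold D_def, rule lyapunov_ratio_le[where c=c and k=k, OF nz])
    have "\<forall>\<^sub>F n in sequentially. 0 \<le> D n"
      using eventually_ge_at_top[of 1] by eventually_elim (rule less_imp_le[OF D0])
    from tendsto_sandwich[OF this upper tendsto_const lim] show ?thesis .
  qed
  \<comment> \<open>The relative error itself is the witness. As the normal tail is positive, the
    product formula then holds exactly, and only convergence remains to be shown.\<close>
  define \<epsilon> where "\<epsilon> n = P n / normal_tail (x n) - 1" for n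
  have "\<epsilon> \<longlonglongrightarrow> 0"
  proof (rule LIMSEQ_I)
    fix r :: real assume r: "0 < r"
    \<comment> \<open>Half of \<open>r\<close> turns the non-strict ratio bound into the strict
      inequality required by the limit.\<close>
    have "0 < beta + 1" "0 < r / 2" using r beta_nonneg by simp_all
    from normalized_sum_tail_ratio[OF p this, where ?'a='a and ?'i=nat]
    obtain \<eta> where \<eta>: "0 < \<eta>" and bound: "\<forall>(M::'a measure) (I::nat set) X s D x.
        (\<forall>\<tau>. 0 < \<tau> \<longrightarrow> \<tau> \<le> 1 \<longrightarrow> D \<le> \<tau> powr (2 * p) \<longrightarrow> normalized_sum M I X s p (beta + 1) \<tau>) \<longrightarrow>
        0 < D \<longrightarrow> D \<le> \<eta> \<longrightarrow> D \<le> exp (- x\<^sup>2 / 2) \<longrightarrow>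
        \<bar>measure M {\<omega> \<in> space M. x \<le> (\<Sum>i\<in>I. X i \<omega>)} - normal_tail x\<bar> \<le> r / 2 * normal_tail x"
      by (elim exE conjE)
    have "\<forall>\<^sub>F n in sequentially. D n < \<eta>" by (rule order_tendstoD(2)[OF D_lim \<eta>])
    then have "\<forall>\<^sub>F n in sequentially. norm (\<epsilon> n - 0) < r"
      using eventually_ge_at_top[of 1]
    proof eventually_elim
      case (elim n)
      note n = nz[OF elim(2)]
      have "\<bar>P n - normal_tail (x n)\<bar> \<le> r / 2 * normal_tail (x n)"
        unfolding P_def weighted_sum_event[where c=c and k=k and n=n, OF n]
        by (rule bound[rule_format, OF normalized_sum_row[where c=c and k=k and n=n, OF n, folded D_def]
              D0[OF elim(2)] less_imp_le[OF elim(1)] Dx[OF elim(2)]])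
      then have ratio: "\<bar>P n - normal_tail (x n)\<bar> / normal_tail (x n) \<le> r / 2"
        using normal_tail_pos[of "x n"] by (simp add: pos_divide_le_eq)
      have "\<epsilon> n = (P n - normal_tail (x n)) / normal_tail (x n)"
        using normal_tail_pos[of "x n"] by (simp add: \<epsilon>_def diff_divide_distrib)
      then have "\<bar>\<epsilon> n\<bar> = \<bar>P n - normal_tail (x n)\<bar> / normal_tail (x n)"
        using normal_tail_pos[of "x n"] by simp
      with ratio r show ?case unfolding real_norm_def diff_0_right by linarith
    qed
    then show "\<exists>no. \<forall>n\<ge>no. norm (\<epsilon> n - 0) < r" by (simp add: eventually_sequentially)
  qed
  moreover have "P n = (1 - std_normal_cdf (x n)) * (1 + \<epsilon> n)" for n
    using normal_tail_pos[of "x n"] by (simp add: \<epsilon>_def flip: normal_tail_def)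
  ultimately show ?thesis unfolding P_def by blast
qed

end
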